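(* Let $X$ and $Y$ be cellular spaces, $X$ compact, equipped with maps $\mu\colon X\to X\vee X$ and $\nu\colon X\to X$ such that $(X,\mu,\nu;Y)$ is an admissible couple, and let $r\ge0$. Then for $\mathbf a,\mathbf b\in[X,Y]$ one has $\mathbf a\overset{r}{\approx}\mathbf b$ if and only if $\mathbf a^{-1}\mathbf b\in[X,Y]^{((r+1))}$.
   Context: Cellular space = based CW complex; maps are based. $(X,\mu,\nu;Y)$ is an admissible couple if $[X,Y]$ is a group with multiplication $[a][b]=[(a\,\bar\vee\, b)\circ\mu]$, inversion $[a]^{-1}=[a\circ\nu]$, identity the constant class ($a\,\bar\vee\, b$ restricts to $a,b$ on the wedge summands). Strong similarity: for a set $W$, $\langle W\rangle$ = free abelian group on $W$. $Y^X$ = based maps (compact-open), based at the constant map; $Y^X_a$ = path component of $a$; $V\mapsto V|_R$ restriction; $\mathcal F_n(X)$ = finite $R\subseteq X$ containing the basepoint with $|R|\le n+1$; $\langle Y^X\rangle^{(s)}=\{V: V|_R=0\ \forall R\in\mathcal F_{s-1}(X)\}$. For unbased $U,V$: $V^{(U)}$ = unbased maps; $\Xi^U(v)$ = constant map at $v$; combining product $\boxed{\sqcup}_i\langle w_i\rangle=\langle w\rangle$, $w|_{U_i}=w_i$ for $U=\coprod U_i$. For nonempty finite $E$: simplex $\Delta E$, faces $\Delta F$; layouts $A$ = sets of pairwise disjoint nonempty subsets; $\Delta[A]=\coprod_{F\in A}\Delta F$; $S$ fissile if $S|_{\Delta[A]}=\boxed{\sqcup}_{F\in A}S|_{\Delta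 F}$ for all layouts. $U\wr X=(U\times X)/(U\times\{x_0\})$, $\#^X(w)(u\wr x)=w(u)(x)$, $\langle (Y^X)^{(U)}\rangle^{(s)}_X=\langle\#^X\rangle^{-1}\langle Y^{U\wr X}\rangle^{(s)}$. $a\overset{r}{\approx}b$ iff for each nonempty finite $E$ there is a fissile $S\in\langle (Y^X_a)^{(\Delta E)}\rangle$ with $\langle\Xi^{\Delta E}(b)\rangle-S\in\langle (Y^X)^{(\Delta E)}\rangle^{(r+1)}_X$. This relation is homotopy invariant; for classes, $[a]\overset{r}{\approx}[b]$ means $a\overset{r}{\approx}b$. $[X,Y]^{((r+1))}=\{\mathbf a\in[X,Y]: 1\overset{r}{\approx}\mathbf a\}$. *)

theory Defs
  imports "HOL-Analysis.Analysis" "HOL-Algebra.Group"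
begin

section \<open>Cellular (based CW) spaces\<close>

text \<open>Closed n-disk, its interior and its boundary sphere, as subspaces of
  the product topology on nat => real (points vanish outside the first n coordinates).\<close>

definition disk_set :: "nat \<Rightarrow> (nat \<Rightarrow> real) set" where
  "disk_set n = {x. (\<Sum>i<n. (x i)\<^sup>2) \<le> 1 \<and> (\<forall>i\<ge>n. x i = 0)}"

definition ball_set :: "nat \<Rightarrow> (nat \<Rightarrow> real) set" where
  "ball_set n = {x. (\<Sum>i<n. (x i)\<^sup>2) < 1 \<and> (\<forall>i\<ge>n. x i = 0)}"

definition disk :: "nat \<Rightarrow> (nat \<Rightarrow> real) topology" where
  "disk n = subtopology (powertop_real UNIV) (disk_set n)"

text \<open>A CW complex (characterisation of Hatcher, Prop. A.2): a Hausdorff space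
  partitioned into open cells e, each with a dimension and a characteristic map
  from the closed disk, restricting to a homeomorphism of the open disk onto e,
  sending the boundary sphere into finitely many cells of lower dimension, and the
  topology is coherent with the characteristic maps.  "Based" means that the
  basepoint is a 0-cell.\<close>

definition cellular :: "'a topology \<Rightarrow> 'a \<Rightarrow> bool" where
  "cellular X x0 \<longleftrightarrow> Hausdorff_space X \<and>
    (\<exists>(C::'a set set) (dim::'a set \<Rightarrow> nat) (\<Phi>::'a set \<Rightarrow> (nat \<Rightarrow> real) \<Rightarrow> 'a).
       \<Union>C = topspace X \<and> {} \<notin> C \<and> pairwise disjnt C \<and>
       (\<forall>e\<in>C. continuous_map (disk (dim e)) X (\<Phi> e) \<and>
          homeomorphic_map (subtopology (powertop_real UNIV) (ball_set (dim e)))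
                           (subtopology X e) (\<Phi> e) \<and>
          (\<exists>D. finite D \<and> D \<subseteq> C \<and> (\<forall>d\<in>D. dim d < dim e) \<and>
               \<Phi> e ` (disk_set (dim e) - ball_set (dim e)) \<subseteq> \<Union>D)) \<and>
       (\<forall>A. A \<subseteq> topspace X \<longrightarrow>
          (closedin X A \<longleftrightarrow>
            (\<forall>e\<in>C. closedin (disk (dim e)) (disk_set (dim e) \<inter> \<Phi> e -` A)))) \<and>
       {x0} \<in> C \<and> dim {x0} = 0)"

section \<open>Based maps, homotopy classes, admissible couples\<close>

text \<open>Based maps X -> Y, represented canonically (extensional on the carrier of X).\<close>
definition based_maps :: "'a topology \<Rightarrow> 'a \<Rightarrow> 'b topology \<Rightarrow> 'b \<Rightarrow> ('a \<Rightarrow> 'b) set" where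
  "based_maps X x0 Y y0 =
     {f. continuous_map X Y f \<and> f x0 = y0 \<and> f \<in> extensional (topspace X)}"

definition const_map :: "'a topology \<Rightarrow> 'b \<Rightarrow> 'a \<Rightarrow> 'b" where
  "const_map X y0 = restrict (\<lambda>_. y0) (topspace X)"

text \<open>Based homotopy class of a based map.\<close>
definition hcls :: "'a topology \<Rightarrow> 'a \<Rightarrow> 'b topology \<Rightarrow> 'b \<Rightarrow> ('a \<Rightarrow> 'b) \<Rightarrow> ('a \<Rightarrow> 'b) set" where
  "hcls X x0 Y y0 f =
     {g \<in> based_maps X x0 Y y0. homotopic_with (\<lambda>h. h x0 = y0) X Y f g}"

definition hrep :: "('a \<Rightarrow> 'b) set \<Rightarrow> 'a \<Rightarrow> 'b" where
  "hrep C = (SOME c. c \<in> C)"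

text \<open>The wedge X v X, realised as the subspace (X x {x0}) u ({x0} x X) of X x X
  (homeomorphic to the quotient wedge since points of a CW complex are closed),
  based at (x0,x0); and the folding map a v b.\<close>
definition wedge :: "'a topology \<Rightarrow> 'a \<Rightarrow> ('a \<times> 'a) topology" where
  "wedge X x0 = subtopology (prod_topology X X) {(x, y). x = x0 \<or> y = x0}"

definition wedge_map :: "'a \<Rightarrow> ('a \<Rightarrow> 'b) \<Rightarrow> ('a \<Rightarrow> 'b) \<Rightarrow> 'a \<times> 'a \<Rightarrow> 'b" where
  "wedge_map x0 a b = (\<lambda>(x, y). if y = x0 then a x else b y)"

text \<open>[X,Y] with the operations induced by mu.\<close>
definition htpy_set ::
  "'a topology \<Rightarrow> 'a \<Rightarrow> ('a \<Rightarrow> 'a \<times> 'a) \<Rightarrow> 'b topology \<Rightarrow> 'b \<Rightarrow> ('a \<Rightarrow> 'b) set monoid" where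
  "htpy_set X x0 \<mu> Y y0 =
     \<lparr> carrier = hcls X x0 Y y0 ` based_maps X x0 Y y0,
       mult = (\<lambda>A B. hcls X x0 Y y0 (wedge_map x0 (hrep A) (hrep B) \<circ> \<mu>)),
       one = hcls X x0 Y y0 (const_map X y0) \<rparr>"

definition admissible ::
  "'a topology \<Rightarrow> 'a \<Rightarrow> ('a \<Rightarrow> 'a \<times> 'a) \<Rightarrow> ('a \<Rightarrow> 'a) \<Rightarrow> 'b topology \<Rightarrow> 'b \<Rightarrow> bool" where
  "admissible X x0 \<mu> \<nu> Y y0 \<longleftrightarrow>
     continuous_map X (wedge X x0) \<mu> \<and> \<mu> x0 = (x0, x0) \<and>
     continuous_map X X \<nu> \<and> \<nu> x0 = x0 \<and>
     group (htpy_set X x0 \<mu> Y y0) \<and>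
     (\<forall>a\<in>based_maps X x0 Y y0.
        hcls X x0 Y y0 (a \<circ> \<nu>) = inv\<^bsub>htpy_set X x0 \<mu> Y y0\<^esub> (hcls X x0 Y y0 a))"

section \<open>Free abelian groups, mapping spaces, simplices\<close>

text \<open>The free abelian group on W: finitely supported integer-valued functions
  supported in W; gen w is the generator of w.\<close>
definition fab :: "'w set \<Rightarrow> ('w \<Rightarrow> int) set" where
  "fab W = {V. finite {w. V w \<noteq> 0} \<and> {w. V w \<noteq> 0} \<subseteq> W}"

definition gen :: "'w \<Rightarrow> 'w \<Rightarrow> int" where
  "gen w = (\<lambda>v. if v = w then 1 else 0)"

text \<open>Y^X: based maps with the compact-open topology.\<close>
definition mapspace :: "'a topology \<Rightarrow> 'a \<Rightarrow> 'b topology \<Rightarrow> 'b \<Rightarrow> ('a \<Rightarrow> 'b) topology" where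
  "mapspace X x0 Y y0 =
     subtopology
       (topology_generated_by {{f. f ` K \<subseteq> U} | K U. compactin X K \<and> openin Y U})
       (based_maps X x0 Y y0)"

text \<open>Unbased (continuous) maps U -> T, canonically represented.\<close>
definition umaps :: "'u topology \<Rightarrow> 't topology \<Rightarrow> ('u \<Rightarrow> 't) set" where
  "umaps U T = {w. continuous_map U T w \<and> w \<in> extensional (topspace U)}"

text \<open>Simplex on a nonempty finite set F (barycentric coordinates).\<close>
definition simplex_set :: "nat set \<Rightarrow> (nat \<Rightarrow> real) set" where
  "simplex_set F = {t. (\<forall>i. 0 \<le> t i) \<and> (\<forall>i. i \<notin> F \<longrightarrow> t i = 0) \<and> (\<Sum>i\<in>F. t i) = 1}"

definition std_simplex :: "nat set \<Rightarrow> (nat \<Rightarrow> real) topology" where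
  "std_simplex F = subtopology (powertop_real UNIV) (simplex_set F)"

text \<open>Layouts of E and the space Delta[A] (disjoint union of the faces, realised as
  the union of these pairwise disjoint closed faces inside Delta E).\<close>
definition layout :: "nat set \<Rightarrow> nat set set \<Rightarrow> bool" where
  "layout E A \<longleftrightarrow> A \<subseteq> Pow E \<and> {} \<notin> A \<and> pairwise disjnt A"

definition layout_set :: "nat set set \<Rightarrow> (nat \<Rightarrow> real) set" where
  "layout_set A = (\<Union>F\<in>A. simplex_set F)"

text \<open>Restriction V |-> V|_T (linear extension of w |-> w|_T).\<close>
definition res :: "'u set \<Rightarrow> (('u \<Rightarrow> 't) \<Rightarrow> int) \<Rightarrow> ('u \<Rightarrow> 't) \<Rightarrow> int" where
  "res T V = (\<lambda>w'. \<Sum>w\<in>{w. V w \<noteq> 0 \<and> restrict w T = w'}. V w)"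

text \<open>Gluing a family of maps on the faces F in A to a map on Delta[A], and the
  combining product (multilinear extension of the gluing).\<close>
definition glue :: "nat set set \<Rightarrow> (nat set \<Rightarrow> (nat \<Rightarrow> real) \<Rightarrow> 't) \<Rightarrow> (nat \<Rightarrow> real) \<Rightarrow> 't" where
  "glue A \<tau> = (\<lambda>t. if \<exists>F\<in>A. t \<in> simplex_set F
                   then \<tau> (SOME F. F \<in> A \<and> t \<in> simplex_set F) t else undefined)"

definition comb :: "nat set set \<Rightarrow> (nat set \<Rightarrow> ((nat \<Rightarrow> real) \<Rightarrow> 't) \<Rightarrow> int)
                    \<Rightarrow> ((nat \<Rightarrow> real) \<Rightarrow> 't) \<Rightarrow> int" where
  "comb A Vf = (\<lambda>w. \<Sum>\<tau>\<in>{\<tau> \<in> (\<Pi>\<^sub>E F\<in>A. {v. Vf F v \<noteq> 0}). glue A \<tau> = w}.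
                     \<Prod>F\<in>A. Vf F (\<tau> F))"

definition fissile :: "nat set \<Rightarrow> (((nat \<Rightarrow> real) \<Rightarrow> 't) \<Rightarrow> int) \<Rightarrow> bool" where
  "fissile E S \<longleftrightarrow>
     (\<forall>A. layout E A \<longrightarrow> res (layout_set A) S = comb A (\<lambda>F. res (simplex_set F) S))"

text \<open>The filtration <(Y^X)^(U)>^(s)_X = <#^X>^{-1} <Y^(U wr X)>^(s), unfolded pointwise:
  a finite R in U wr X containing the basepoint is {*} together with a finite set R'
  of points u wr x (u in U, x in X, x ~= x0), |R| = |R'| + 1, and the restriction of
  #^X(w) to R is determined by (u,x) |-> w u x on R'.\<close>
definition wr_filt :: "'a topology \<Rightarrow> 'a \<Rightarrow> 'u topology \<Rightarrow> nat
                       \<Rightarrow> (('u \<Rightarrow> 'a \<Rightarrow> 'b) \<Rightarrow> int) \<Rightarrow> bool" where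
  "wr_filt X x0 U s V \<longleftrightarrow>
     (\<forall>R. finite R \<and> R \<subseteq> topspace U \<times> (topspace X - {x0}) \<and> card R + 1 \<le> s \<longrightarrow>
        (\<forall>\<phi>. (\<Sum>w\<in>{w. V w \<noteq> 0 \<and> restrict (\<lambda>(u, x). w u x) R = \<phi>}. V w) = 0))"

section \<open>Strong similarity\<close>

definition ssim :: "'a topology \<Rightarrow> 'a \<Rightarrow> 'b topology \<Rightarrow> 'b \<Rightarrow> nat
                    \<Rightarrow> ('a \<Rightarrow> 'b) \<Rightarrow> ('a \<Rightarrow> 'b) \<Rightarrow> bool" where
  "ssim X x0 Y y0 r a b \<longleftrightarrow>
     (\<forall>E::nat set. finite E \<and> E \<noteq> {} \<longrightarrow>
        (\<exists>S. S \<in> fab (umaps (std_simplex E)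
                        (subtopology (mapspace X x0 Y y0)
                           (path_component_of_set (mapspace X x0 Y y0) a))) \<and>
             fissile E S \<and>
             wr_filt X x0 (std_simplex E) (r + 1)
               (\<lambda>w. gen (const_map (std_simplex E) b) w - S w)))"

text \<open>On homotopy classes (via representatives; the relation is homotopy invariant).\<close>
definition ssim_cls :: "'a topology \<Rightarrow> 'a \<Rightarrow> 'b topology \<Rightarrow> 'b \<Rightarrow> nat
                        \<Rightarrow> ('a \<Rightarrow> 'b) set \<Rightarrow> ('a \<Rightarrow> 'b) set \<Rightarrow> bool" where
  "ssim_cls X x0 Y y0 r A B \<longleftrightarrow> ssim X x0 Y y0 r (hrep A) (hrep B)"

text \<open>htpy_filt X x0 mu Y y0 r is [X,Y]^((r+1)).\<close>
definition htpy_filt :: "'a topology \<Rightarrow> 'a \<Rightarrow> ('a \<Rightarrow> 'a \<times> 'a) \<Rightarrow> 'b topology \<Rightarrow> 'b \<Rightarrow> nat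
                         \<Rightarrow> ('a \<Rightarrow> 'b) set set" where
  "htpy_filt X x0 \<mu> Y y0 r =
     {C \<in> carrier (htpy_set X x0 \<mu> Y y0).
        ssim_cls X x0 Y y0 r (one (htpy_set X x0 \<mu> Y y0)) C}"

end

theory Submission
  imports Defs
begin

text \<open>
  Left multiplication by a fixed class \<open>[c]\<close> is induced by the self-map
  \<open>f \<mapsto> (c \<or> f) \<circ> \<mu>\<close> of the mapping space, whose value at \<open>x\<close> depends on at most one value of \<open>f\<close>.
  Pushing the formal sum \<open>S\<close> forward along such a local self-map preserves fissility and the
  filtration, so \<open>a \<approx> b\<close> implies \<open>ca \<approx> cb\<close>; taking \<open>c = a\<inverse>\<close>, and \<open>c = a\<close> for the converse,
  gives the theorem, provided strong similarity is homotopy invariant.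

  Invariance in \<open>a\<close> holds because only its path component enters. For \<open>b\<close>, all maps in question
  take values in a finite subcomplex \<open>K\<close> of \<open>Y\<close>, and there the two projections \<open>K \<times> K \<rightarrow> K\<close> are
  homotopic near the diagonal. Hence, when \<open>b\<close> and \<open>b'\<close> are close, there is a family of self-maps of
  \<open>K\<close> indexed by \<open>x \<in> X\<close>, deformable to the identity, that sends \<open>b x\<close> to \<open>b' x\<close>. It acts on the
  mapping space as a local self-map that preserves path components and carries \<open>b\<close> to \<open>b'\<close>. An
  arbitrary homotopy is a chain of such small steps.
\<close>

section \<open>Pushforward of formal sums\<close>

text \<open>The filtration tests exact values at finitely many points, so in
  \<open>gen (const_map U b) w - S w\<close> the map \<open>b\<close> cannot simply be replaced by a
  homotopic one. What is needed is an operation on maps that hits \<open>b'\<close> on the nose,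
  that is local and therefore respects the filtration, and that moves every map within its homotopy
  class. This cannot be sidestepped: \<open>ssim_cls\<close> compares chosen representatives, and
  the representative of a product class agrees with the product of representatives only up to
  homotopy.

  Passing to a finite subcomplex makes an induction on cells possible; it also makes
  \<open>X \<times> K\<close> compact Hausdorff, hence normal, so that a Urysohn function can switch
  the homotopy of the projections off away from the graph of \<open>b\<close>. Of that homotopy only
  the two ends and the fixed basepoint enter the transport, which is why no condition is imposed
  along the diagonal.\<close>

definition pushfwd :: "('w \<Rightarrow> 'v) \<Rightarrow> ('w \<Rightarrow> int) \<Rightarrow> 'v \<Rightarrow> int" where
  "pushfwd g V = (\<lambda>v. \<Sum>w\<in>{w. V w \<noteq> 0 \<and> g w = v}. V w)"

text \<open>The sum defining \<open>pushfwd\<close> runs over a set that changes with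
  \<open>g\<close>, \<open>V\<close> and \<open>v\<close>. A fixed finite index set containing the
  support turns linearity and functoriality into exchanges of finite sums.\<close>

lemma pushfwd_eq_sum:
  assumes "finite W" "{w. V w \<noteq> 0} \<subseteq> W"
  shows "pushfwd g V v = (\<Sum>w\<in>W. if g w = v then V w else 0)"
proof -
  have "(\<Sum>w\<in>W. if g w = v then V w else 0) = (\<Sum>w\<in>{w\<in>W. g w = v}. V w)"
    using assms by (simp add: sum.inter_filter)
  also have "\<dots> = (\<Sum>w\<in>{w. V w \<noteq> 0 \<and> g w = v}. V w)"
    using assms by (intro sum.mono_neutral_right) auto
  finally show ?thesis by (simp add: pushfwd_def)
qed

lemma support_pushfwd: "{v. pushfwd g V v \<noteq> 0} \<subseteq> g ` {w. V w \<noteq> 0}"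
proof
  fix v assume v: "v \<in> {v. pushfwd g V v \<noteq> 0}"
  have "{w. V w \<noteq> 0 \<and> g w = v} \<noteq> {}"
  proof
    assume "{w. V w \<noteq> 0 \<and> g w = v} = {}"
    then have "pushfwd g V v = 0" unfolding pushfwd_def by (simp only: sum.empty)
    with v show False by simp
  qed
  then show "v \<in> g ` {w. V w \<noteq> 0}" by auto
qed

lemma finite_support_pushfwd:
  "finite {w. V w \<noteq> 0} \<Longrightarrow> finite {v. pushfwd g V v \<noteq> 0}"
  by (rule finite_subset[OF support_pushfwd finite_imageI])

lemma pushfwd_comp:
  assumes "finite {w. V w \<noteq> 0}"
  shows "pushfwd h (pushfwd g V) = pushfwd (\<lambda>w. h (g w)) V"
proof
  fix x
  let ?W = "{w. V w \<noteq> 0}"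
  have "pushfwd h (pushfwd g V) x = (\<Sum>v\<in>g ` ?W. if h v = x then pushfwd g V v else 0)"
    by (rule pushfwd_eq_sum) (simp_all add: assms support_pushfwd)
  also have "\<dots> = (\<Sum>v\<in>g ` ?W. \<Sum>w\<in>?W. if g w = v then (if h v = x then V w else 0) else 0)"
  proof (rule sum.cong[OF refl])
    fix v show "(if h v = x then pushfwd g V v else 0)
        = (\<Sum>w\<in>?W. if g w = v then (if h v = x then V w else 0) else 0)"
      by (cases "h v = x") (simp_all add: pushfwd_eq_sum[OF assms subset_refl] cong: if_cong)
  qed
  also have "\<dots> = (\<Sum>w\<in>?W. \<Sum>v\<in>g ` ?W. if g w = v then (if h v = x then V w else 0) else 0)"
    by (rule sum.swap)
  also have "\<dots> = (\<Sum>w\<in>?W. if h (g w) = x then V w else 0)"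
    using assms by (intro sum.cong) (auto simp: sum.delta)
  also have "\<dots> = pushfwd (\<lambda>w. h (g w)) V x"
    using assms by (intro pushfwd_eq_sum[symmetric]) auto
  finally show "pushfwd h (pushfwd g V) x = pushfwd (\<lambda>w. h (g w)) V x" .
qed

lemma pushfwd_cong:
  assumes "\<And>w. V w \<noteq> 0 \<Longrightarrow> g w = h w"
  shows "pushfwd g V = pushfwd h V"
proof -
  have "{w. V w \<noteq> 0 \<and> g w = v} = {w. V w \<noteq> 0 \<and> h w = v}" for v using assms by auto
  then show ?thesis by (simp add: pushfwd_def)
qed

lemma pushfwd_diff:
  assumes "finite {w. V w \<noteq> 0}" "finite {w. W w \<noteq> 0}"
  shows "pushfwd g (\<lambda>w. V w - W w) v = pushfwd g V v - pushfwd g W v"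
proof -
  let ?U = "{w. V w \<noteq> 0} \<union> {w. W w \<noteq> 0}"
  have U: "finite ?U" using assms by simp
  have "pushfwd g (\<lambda>w. V w - W w) v = (\<Sum>w\<in>?U. if g w = v then V w - W w else 0)"
    using U by (intro pushfwd_eq_sum) auto
  also have "\<dots> = (\<Sum>w\<in>?U. if g w = v then V w else 0) - (\<Sum>w\<in>?U. if g w = v then W w else 0)"
    by (subst sum_subtractf[symmetric]) (auto intro: sum.cong)
  also have "(\<Sum>w\<in>?U. if g w = v then V w else 0) = pushfwd g V v"
    using U by (intro pushfwd_eq_sum[symmetric]) auto
  also have "(\<Sum>w\<in>?U. if g w = v then W w else 0) = pushfwd g W v"
    using U by (intro pushfwd_eq_sum[symmetric]) auto
  finally show ?thesis .
qed

lemma pushfwd_gen: "pushfwd g (gen w) = gen (g w)"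
proof
  fix v
  have "pushfwd g (gen w) v = (\<Sum>u\<in>{w}. if g u = v then gen w u else 0)"
    by (rule pushfwd_eq_sum) (auto simp: gen_def)
  then show "pushfwd g (gen w) v = gen (g w) v" by (auto simp: gen_def)
qed

section \<open>Restriction, filtration and combining product in terms of pushforwards\<close>

lemma res_eq_pushfwd: "res T V = pushfwd (\<lambda>w. restrict w T) V"
  by (simp add: res_def pushfwd_def)

lemma wr_filt_iff_pushfwd:
  "wr_filt X x0 U s V \<longleftrightarrow>
     (\<forall>R. finite R \<and> R \<subseteq> topspace U \<times> (topspace X - {x0}) \<and> card R + 1 \<le> s \<longrightarrow>
        pushfwd (\<lambda>w. restrict (\<lambda>(u, x). w u x) R) V = (\<lambda>_. 0))"
  by (simp add: wr_filt_def pushfwd_def fun_eq_iff)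

text \<open>Index sets \<open>W F\<close> may exceed the supports: a family that leaves a support
  has a zero factor and adds nothing.\<close>

lemma comb_eq_sum:
  assumes "finite A" "\<And>F. F \<in> A \<Longrightarrow> finite (W F)" "\<And>F. F \<in> A \<Longrightarrow> {v. Vf F v \<noteq> 0} \<subseteq> W F"
  shows "comb A Vf w = (\<Sum>\<tau>\<in>Pi\<^sub>E A W. if glue A \<tau> = w then \<Prod>F\<in>A. Vf F (\<tau> F) else 0)"
proof -
  have fin: "finite (Pi\<^sub>E A W)" using assms by (intro finite_PiE) auto
  have "(\<Sum>\<tau>\<in>Pi\<^sub>E A W. if glue A \<tau> = w then \<Prod>F\<in>A. Vf F (\<tau> F) else 0)
      = (\<Sum>\<tau>\<in>{\<tau>\<in>Pi\<^sub>E A W. glue A \<tau> = w}. \<Prod>F\<in>A. Vf F (\<tau> F))"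
    using fin by (simp add: sum.inter_filter)
  also have "\<dots> = comb A Vf w"
    unfolding comb_def
  proof (rule sum.mono_neutral_right)
    show "finite {\<tau>\<in>Pi\<^sub>E A W. glue A \<tau> = w}" using fin by simp
    show "{\<tau> \<in> \<Pi>\<^sub>E F\<in>A. {v. Vf F v \<noteq> 0}. glue A \<tau> = w} \<subseteq> {\<tau>\<in>Pi\<^sub>E A W. glue A \<tau> = w}"
      using assms(3) by (auto simp: PiE_iff subset_iff)
    show "\<forall>i\<in>{\<tau>\<in>Pi\<^sub>E A W. glue A \<tau> = w} - {\<tau> \<in> \<Pi>\<^sub>E F\<in>A. {v. Vf F v \<noteq> 0}. glue A \<tau> = w}.
        (\<Prod>F\<in>A. Vf F (i F)) = 0"
      using assms(1) by (auto simp: PiE_iff)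
  qed
  finally show ?thesis by simp
qed

lemma comb_cong:
  assumes "\<And>F. F \<in> A \<Longrightarrow> Vf F = Vg F"
  shows "comb A Vf = comb A Vg"
proof
  fix w
  have "(\<Pi>\<^sub>E F\<in>A. {v. Vf F v \<noteq> 0}) = (\<Pi>\<^sub>E F\<in>A. {v. Vg F v \<noteq> 0})"
    using assms by (intro PiE_cong) simp
  moreover have "(\<Prod>F\<in>A. Vf F (\<tau> F)) = (\<Prod>F\<in>A. Vg F (\<tau> F))" for \<tau>
    using assms by (intro prod.cong) simp_all
  ultimately show "comb A Vf w = comb A Vg w" by (simp only: comb_def)
qed

text \<open>\<open>PiE\<close> admits only families that are \<open>undefined\<close> off
  \<open>A\<close>, which the pointwise image of a family need not be.\<close>

lemma glue_restrict: "glue A (restrict \<tau> A) = glue A \<tau>"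
proof
  fix t
  show "glue A (restrict \<tau> A) t = glue A \<tau> t"
  proof (cases "\<exists>F\<in>A. t \<in> simplex_set F")
    case True
    then have "\<exists>F. F \<in> A \<and> t \<in> simplex_set F" by blast
    from someI_ex[OF this] show ?thesis using True by (simp add: glue_def)
  qed (simp add: glue_def)
qed

text \<open>Both sides look up the same face, the one picked by \<open>SOME\<close>, so an operation
  on values commutes with gluing; off the faces both are \<open>undefined\<close>.\<close>

lemma glue_natural:
  "glue A (\<lambda>F. restrict (\<lambda>u. P (\<tau> F u)) (simplex_set F))
     = restrict (\<lambda>u. P (glue A \<tau> u)) (layout_set A)"
proof
  fix t
  show "glue A (\<lambda>F. restrict (\<lambda>u. P (\<tau> F u)) (simplex_set F)) t
     = restrict (\<lambda>u. P (glue A \<tau> u)) (layout_set A) t"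
  proof (cases "\<exists>F\<in>A. t \<in> simplex_set F")
    case True
    then have "\<exists>F. F \<in> A \<and> t \<in> simplex_set F" by blast
    from someI_ex[OF this] show ?thesis using True by (simp add: glue_def layout_set_def)
  qed (simp add: glue_def layout_set_def)
qed

text \<open>Multilinearity of the combining product: expanding the product over faces of sums over
  fibres of \<open>q F\<close> gives one sum over families \<open>\<tau>\<close>. By naturality of
  gluing both sides collect the families with \<open>Q (glue A \<tau>) = w\<close>, weighted by the
  product of their coefficients.\<close>

lemma pushfwd_comb:
  assumes A: "finite A" and fin: "\<And>F. F \<in> A \<Longrightarrow> finite {v. Vf F v \<noteq> 0}"
    and nat: "\<And>\<tau>. glue A (\<lambda>F. q F (\<tau> F)) = Q (glue A \<tau>)"
  shows "pushfwd Q (comb A Vf) = comb A (\<lambda>F. pushfwd (q F) (Vf F))"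
proof
  fix w
  let ?W = "\<lambda>F. {v. Vf F v \<noteq> 0}"
  let ?T = "Pi\<^sub>E A ?W"
  let ?T' = "Pi\<^sub>E A (\<lambda>F. q F ` ?W F)"
  let ?p = "\<lambda>\<tau>. \<Prod>F\<in>A. Vf F (\<tau> F)"
  let ?m = "\<lambda>\<tau>. \<lambda>F\<in>A. q F (\<tau> F)"
  have finT: "finite ?T" by (intro finite_PiE A fin)
  have finT': "finite ?T'" by (intro finite_PiE finite_imageI A fin)
  have comb: "comb A Vf v = (\<Sum>\<tau>\<in>?T. if glue A \<tau> = v then ?p \<tau> else 0)" for v
    by (rule comb_eq_sum) (simp_all add: A fin)
  have supp: "{v. comb A Vf v \<noteq> 0} \<subseteq> glue A ` ?T"
  proof
    fix v assume "v \<in> {v. comb A Vf v \<noteq> 0}"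
    then have "(\<Sum>\<tau>\<in>?T. if glue A \<tau> = v then ?p \<tau> else 0) \<noteq> 0" by (simp add: comb)
    then obtain \<tau> where "\<tau> \<in> ?T" "(if glue A \<tau> = v then ?p \<tau> else 0) \<noteq> 0"
      by (rule sum.not_neutral_contains_not_neutral)
    then show "v \<in> glue A ` ?T" by (cases "glue A \<tau> = v") auto
  qed
  have "pushfwd Q (comb A Vf) w = (\<Sum>v\<in>glue A ` ?T. if Q v = w then comb A Vf v else 0)"
    by (rule pushfwd_eq_sum) (simp_all add: finT supp)
  also have "\<dots> = (\<Sum>v\<in>glue A ` ?T. \<Sum>\<tau>\<in>?T. if glue A \<tau> = v then (if Q v = w then ?p \<tau> else 0) else 0)"
  proof (rule sum.cong[OF refl])
    fix v show "(if Q v = w then comb A Vf v else 0)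
        = (\<Sum>\<tau>\<in>?T. if glue A \<tau> = v then (if Q v = w then ?p \<tau> else 0) else 0)"
      by (cases "Q v = w") (simp_all add: comb cong: if_cong)
  qed
  also have "\<dots> = (\<Sum>\<tau>\<in>?T. \<Sum>v\<in>glue A ` ?T. if glue A \<tau> = v then (if Q v = w then ?p \<tau> else 0) else 0)"
    by (rule sum.swap)
  also have "\<dots> = (\<Sum>\<tau>\<in>?T. if Q (glue A \<tau>) = w then ?p \<tau> else 0)"
    by (rule sum.cong[OF refl]) (simp only: sum.delta'[OF finite_imageI[OF finT]] imageI if_True)
  finally have lhs: "pushfwd Q (comb A Vf) w = (\<Sum>\<tau>\<in>?T. if Q (glue A \<tau>) = w then ?p \<tau> else 0)" .
  have gm: "glue A (?m \<tau>) = Q (glue A \<tau>)" for \<tau> by (simp add: glue_restrict nat)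
  have mT': "?m \<tau> \<in> ?T'" if "\<tau> \<in> ?T" for \<tau> using that by (auto simp: PiE_iff)
  \<comment> \<open>By distributivity the product of fibre sums is a sum over families, and a family
    survives exactly when it matches on every face, that is when its image \<open>?m \<tau>\<close>
    is \<open>\<tau>'\<close>.\<close>
  have prod: "(\<Prod>F\<in>A. pushfwd (q F) (Vf F) (\<tau>' F)) = (\<Sum>\<tau>\<in>?T. if ?m \<tau> = \<tau>' then ?p \<tau> else 0)"
    if \<tau>': "\<tau>' \<in> ?T'" for \<tau>'
  proof -
    have "(\<Prod>F\<in>A. pushfwd (q F) (Vf F) (\<tau>' F))
        = (\<Prod>F\<in>A. \<Sum>v\<in>?W F. if q F v = \<tau>' F then Vf F v else 0)"
      by (intro prod.cong refl pushfwd_eq_sum fin subset_refl)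
    also have "\<dots> = (\<Sum>\<tau>\<in>?T. \<Prod>F\<in>A. if q F (\<tau> F) = \<tau>' F then Vf F (\<tau> F) else 0)"
      using A fin by (rule prod_sum_PiE)
    also have "\<dots> = (\<Sum>\<tau>\<in>?T. if ?m \<tau> = \<tau>' then ?p \<tau> else 0)"
    proof (rule sum.cong[OF refl])
      fix \<tau> assume "\<tau> \<in> ?T"
      show "(\<Prod>F\<in>A. if q F (\<tau> F) = \<tau>' F then Vf F (\<tau> F) else 0) = (if ?m \<tau> = \<tau>' then ?p \<tau> else 0)"
      proof (cases "?m \<tau> = \<tau>'")
        case True
        have "q F (\<tau> F) = \<tau>' F" if "F \<in> A" for F using fun_cong[OF True, of F] that by simp
        then have "(\<Prod>F\<in>A. if q F (\<tau> F) = \<tau>' F then Vf F (\<tau> F) else 0) = ?p \<tau>"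
          by (intro prod.cong) auto
        then show ?thesis using True by simp
      next
        case False
        have "\<exists>F\<in>A. q F (\<tau> F) \<noteq> \<tau>' F"
        proof (rule ccontr)
          assume "\<not> ?thesis"
          then have "?m \<tau> = \<tau>'" using \<tau>' by (intro extensionalityI[of _ A]) (auto simp: PiE_iff)
          with False show False by blast
        qed
        then have "(\<Prod>F\<in>A. if q F (\<tau> F) = \<tau>' F then Vf F (\<tau> F) else 0) = 0"
          using A by (auto simp: prod_zero_iff)
        then show ?thesis using False by simp
      qed
    qed
    finally show ?thesis .
  qed
  have "comb A (\<lambda>F. pushfwd (q F) (Vf F)) w
      = (\<Sum>\<tau>'\<in>?T'. if glue A \<tau>' = w then \<Prod>F\<in>A. pushfwd (q F) (Vf F) (\<tau>' F) else 0)"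
    by (rule comb_eq_sum) (simp_all add: A fin support_pushfwd)
  also have "\<dots> = (\<Sum>\<tau>'\<in>?T'. \<Sum>\<tau>\<in>?T. if ?m \<tau> = \<tau>' then (if glue A \<tau>' = w then ?p \<tau> else 0) else 0)"
  proof (rule sum.cong[OF refl])
    fix \<tau>' assume "\<tau>' \<in> ?T'"
    from prod[OF this] show "(if glue A \<tau>' = w then \<Prod>F\<in>A. pushfwd (q F) (Vf F) (\<tau>' F) else 0)
        = (\<Sum>\<tau>\<in>?T. if ?m \<tau> = \<tau>' then (if glue A \<tau>' = w then ?p \<tau> else 0) else 0)"
      by (cases "glue A \<tau>' = w") (simp_all cong: if_cong)
  qed
  also have "\<dots> = (\<Sum>\<tau>\<in>?T. \<Sum>\<tau>'\<in>?T'. if ?m \<tau> = \<tau>' then (if glue A \<tau>' = w then ?p \<tau> else 0) else 0)"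
    by (rule sum.swap)
  also have "\<dots> = (\<Sum>\<tau>\<in>?T. if Q (glue A \<tau>) = w then ?p \<tau> else 0)"
  proof (rule sum.cong[OF refl])
    fix \<tau> assume "\<tau> \<in> ?T"
    then show "(\<Sum>\<tau>'\<in>?T'. if ?m \<tau> = \<tau>' then (if glue A \<tau>' = w then ?p \<tau> else 0) else 0)
        = (if Q (glue A \<tau>) = w then ?p \<tau> else 0)"
      using mT'[of \<tau>] by (simp only: sum.delta'[OF finT'] gm if_True)
  qed
  finally show "pushfwd Q (comb A Vf) w = comb A (\<lambda>F. pushfwd (q F) (Vf F)) w"
    using lhs by simp
qed

text \<open>Applying \<open>P\<close> to each value commutes with restriction to subsets of the
  simplex and with gluing. Hence the pushforward commutes with \<open>res\<close> and, by
  \<open>pushfwd_comb\<close>, with \<open>comb\<close>, and the fissility equation of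
  \<open>S\<close> is carried to that of its image.\<close>

lemma fissile_pushfwd:
  assumes E: "finite E" and S: "finite {w. S w \<noteq> 0}" and fis: "fissile E S"
  shows "fissile E (pushfwd (\<lambda>w. restrict (\<lambda>u. P (w u)) (simplex_set E)) S)" (is "fissile E ?S'")
  unfolding fissile_def
proof (intro allI impI)
  fix A assume A: "layout E A"
  then have AE: "A \<subseteq> Pow E" by (simp add: layout_def)
  with E have finA: "finite A" by (meson finite_Pow_iff finite_subset)
  let ?Q = "\<lambda>T w. restrict (\<lambda>u. P (w u)) T"
  have sub: "simplex_set F \<subseteq> simplex_set E" if "F \<subseteq> E" for F
  proof
    fix t assume t: "t \<in> simplex_set F"
    have "(\<Sum>i\<in>E. t i) = (\<Sum>i\<in>F. t i)"
      using E that t by (intro sum.mono_neutral_right) (auto simp: simplex_set_def)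
    then show "t \<in> simplex_set E" using t that by (auto simp: simplex_set_def)
  qed
  have res: "res T ?S' = pushfwd (?Q T) (res T S)" if "T \<subseteq> simplex_set E" for T
  proof -
    have "restrict (?Q (simplex_set E) w) T = ?Q T (restrict w T)" for w
      using that by (auto simp: restrict_def fun_eq_iff)
    then show ?thesis using S by (simp add: res_eq_pushfwd pushfwd_comp)
  qed
  have fin: "finite {w. res T S w \<noteq> 0}" for T
    unfolding res_eq_pushfwd using S by (rule finite_support_pushfwd)
  have "layout_set A \<subseteq> simplex_set E" using sub AE by (auto simp: layout_set_def)
  then have "res (layout_set A) ?S' = pushfwd (?Q (layout_set A)) (res (layout_set A) S)"
    by (rule res)
  also have "\<dots> = pushfwd (?Q (layout_set A)) (comb A (\<lambda>F. res (simplex_set F) S))"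
    using fis A by (simp add: fissile_def)
  also have "\<dots> = comb A (\<lambda>F. pushfwd (?Q (simplex_set F)) (res (simplex_set F) S))"
    using finA fin glue_natural by (rule pushfwd_comb)
  also have "\<dots> = comb A (\<lambda>F. res (simplex_set F) ?S')"
    using AE by (intro comb_cong res[symmetric] sub) auto
  finally show "res (layout_set A) ?S' = comb A (\<lambda>F. res (simplex_set F) ?S')" .
qed

text \<open>On the support of \<open>V\<close>, \<open>g\<close> is \<open>?k\<close> after
  \<open>f\<close>, where \<open>?k\<close> evaluates \<open>g\<close> at any chosen preimage.
  Functoriality then writes the pushforward along \<open>g\<close> as an image of zero.\<close>

lemma pushfwd_factors_zero:
  assumes V: "finite {w. V w \<noteq> 0}" and zero: "pushfwd f V = (\<lambda>_. 0)"
    and fac: "\<And>w w'. V w \<noteq> 0 \<Longrightarrow> V w' \<noteq> 0 \<Longrightarrow> f w = f w' \<Longrightarrow> g w = g w'"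
  shows "pushfwd g V = (\<lambda>_. 0)"
proof -
  let ?k = "\<lambda>v. g (SOME w. V w \<noteq> 0 \<and> f w = v)"
  have "?k (f w) = g w" if "V w \<noteq> 0" for w
  proof -
    have "\<exists>w'. V w' \<noteq> 0 \<and> f w' = f w" using that by blast
    from someI_ex[OF this] show ?thesis using fac[OF _ that] by blast
  qed
  then have "pushfwd g V = pushfwd (\<lambda>w. ?k (f w)) V" by (intro pushfwd_cong) auto
  also have "\<dots> = pushfwd ?k (pushfwd f V)" using V by (simp add: pushfwd_comp)
  also have "\<dots> = (\<lambda>_. 0)" using zero by (simp add: pushfwd_def fun_eq_iff)
  finally show ?thesis .
qed

text \<open>A point \<open>\<xi> x\<close> may be the basepoint; it then imposes no condition, since all maps agree there.\<close>

lemma wr_filt_pushfwd: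
  assumes V: "finite {w. V w \<noteq> 0}" and filt: "wr_filt X x0 U s V"
    and \<xi>: "\<And>x. x \<in> topspace X \<Longrightarrow> \<xi> x \<in> topspace X"
    and loc: "\<And>f g x. f \<in> M \<Longrightarrow> g \<in> M \<Longrightarrow> x \<in> topspace X \<Longrightarrow> f (\<xi> x) = g (\<xi> x) \<Longrightarrow> P f x = P g x"
    and M: "\<And>w u. V w \<noteq> 0 \<Longrightarrow> u \<in> topspace U \<Longrightarrow> w u \<in> M"
    and base: "\<And>f. f \<in> M \<Longrightarrow> f x0 = y0"
  shows "wr_filt X x0 U s (pushfwd (\<lambda>w. restrict (\<lambda>u. P (w u)) (topspace U)) V)"
  unfolding wr_filt_iff_pushfwd
proof (intro allI impI)
  fix R assume R: "finite R \<and> R \<subseteq> topspace U \<times> (topspace X - {x0}) \<and> card R + 1 \<le> s"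
  \<comment> \<open>These are the points at which values are actually read. Several points of
    \<open>R\<close> may collapse to one, and those sent to the basepoint are dropped, so the
    cardinality can only decrease and the bound by \<open>s\<close> persists.\<close>
  let ?R' = "{p \<in> (\<lambda>(u, x). (u, \<xi> x)) ` R. snd p \<noteq> x0}"
  have "card ?R' \<le> card ((\<lambda>(u, x). (u, \<xi> x)) ` R)" using R by (intro card_mono) auto
  also have "\<dots> \<le> card R" using R by (intro card_image_le) auto
  finally have card: "card ?R' + 1 \<le> s" using R by linarith
  have "?R' \<subseteq> topspace U \<times> (topspace X - {x0})"
  proof
    fix p assume "p \<in> ?R'"
    then obtain u x where "(u, x) \<in> R" "p = (u, \<xi> x)" "\<xi> x \<noteq> x0" by auto
    moreover from this R have "u \<in> topspace U" "x \<in> topspace X" by auto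
    ultimately show "p \<in> topspace U \<times> (topspace X - {x0})" using \<xi>[of x] by simp
  qed
  then have zero: "pushfwd (\<lambda>w. restrict (\<lambda>(u, x). w u x) ?R') V = (\<lambda>_. 0)"
    using filt[unfolded wr_filt_iff_pushfwd, rule_format, of ?R'] R card by simp
  have "pushfwd (\<lambda>w. restrict (\<lambda>(u, x). restrict (\<lambda>u. P (w u)) (topspace U) u x) R) V = (\<lambda>_. 0)"
  proof (rule pushfwd_factors_zero[OF V zero])
    fix w w' assume w: "V w \<noteq> 0" "V w' \<noteq> 0"
      and eq: "restrict (\<lambda>(u, x). w u x) ?R' = restrict (\<lambda>(u, x). w' u x) ?R'"
    have "P (w u) x = P (w' u) x" if ux: "(u, x) \<in> R" for u x
    proof (rule loc)
      have u: "u \<in> topspace U" and x: "x \<in> topspace X" using R ux by auto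
      show "x \<in> topspace X" by (rule x)
      show "w u \<in> M" "w' u \<in> M" using M w u by blast+
      show "w u (\<xi> x) = w' u (\<xi> x)"
      proof (cases "\<xi> x = x0")
        case True
        then show ?thesis using base[OF \<open>w u \<in> M\<close>] base[OF \<open>w' u \<in> M\<close>] by simp
      next
        case False
        moreover have "(u, \<xi> x) \<in> (\<lambda>(u, x). (u, \<xi> x)) ` R" using ux by (rule image_eqI[rotated]) simp
        ultimately have "(u, \<xi> x) \<in> ?R'" by simp
        then show ?thesis using fun_cong[OF eq, of "(u, \<xi> x)"] by simp
      qed
    qed
    moreover have "u \<in> topspace U" if "(u, x) \<in> R" for u x using R that by auto
    ultimately show "restrict (\<lambda>(u, x). restrict (\<lambda>u. P (w u)) (topspace U) u x) R
        = restrict (\<lambda>(u, x). restrict (\<lambda>u. P (w' u)) (topspace U) u x) R"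
      by (intro restrict_ext) auto
  qed
  then show "pushfwd (\<lambda>w. restrict (\<lambda>(u, x). w u x) R)
      (pushfwd (\<lambda>w. restrict (\<lambda>u. P (w u)) (topspace U)) V) = (\<lambda>_. 0)"
    by (simp only: pushfwd_comp[OF V])
qed

section \<open>Mapping spaces out of compact Hausdorff spaces\<close>

lemma topspace_mapspace: "topspace (mapspace X x0 Y y0) = based_maps X x0 Y y0"
proof -
  \<comment> \<open>With \<open>K\<close> empty the subbasic set is \<open>UNIV\<close>, so the
    generated topology lives on all functions before it is cut down to based maps.\<close>
  have "(UNIV::('a \<Rightarrow> 'b) set) \<in> {{f. f ` K \<subseteq> U} | K U. compactin X K \<and> openin Y U}"
    by (intro CollectI exI[of _ "{}"]) auto
  then have "\<Union>{{f. f ` K \<subseteq> U} | K U. compactin X K \<and> openin Y U} = (UNIV::('a \<Rightarrow> 'b) set)" by blast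
  then show ?thesis by (simp add: mapspace_def topology_generated_by_topspace)
qed

text \<open>Tube argument in closed form: the \<open>u\<close> for which \<open>w u\<close> fails to
  send \<open>K\<close> into \<open>V\<close> form the projection of a closed subset of
  \<open>U \<times> K\<close>, and projecting along the compact \<open>K\<close> is a closed
  map.\<close>

lemma continuous_map_into_mapspace:
  assumes based: "\<And>u. u \<in> topspace U \<Longrightarrow> w u \<in> based_maps X x0 Y y0"
    and cont: "continuous_map (prod_topology U X) Y (\<lambda>(u, x). w u x)"
  shows "continuous_map U (mapspace X x0 Y y0) w"
  unfolding mapspace_def continuous_map_in_subtopology
proof (intro conjI continuous_on_generated_topo)
  show "w \<in> topspace U \<rightarrow> based_maps X x0 Y y0" using based by auto
  show "w ` topspace U \<subseteq> \<Union>{{f. f ` K \<subseteq> V} | K V. compactin X K \<and> openin Y V}"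
    by (intro order.trans[OF subset_UNIV Union_upper] CollectI exI[of _ "{}"]) auto
  fix B assume "B \<in> {{f. f ` K \<subseteq> V} | K V. compactin X K \<and> openin Y V}"
  then obtain K V where K: "compactin X K" and V: "openin Y V" and B: "B = {f. f ` K \<subseteq> V}" by blast
  have KX: "K \<subseteq> topspace X" using K by (rule compactin_subset_topspace)
  let ?XK = "subtopology X K"
  have cont': "continuous_map (prod_topology U ?XK) Y (\<lambda>(u, x). w u x)"
    using continuous_map_from_subtopology[OF cont, of "topspace U \<times> K"]
    by (simp only: prod_topology_subtopology(2))
  let ?C = "{p \<in> topspace (prod_topology U ?XK). (case p of (u, x) \<Rightarrow> w u x) \<in> topspace Y - V}"
  have "closedin (prod_topology U ?XK) ?C"
    using cont' V by (intro closedin_continuous_map_preimage) auto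
  moreover have "closed_map (prod_topology U ?XK) U fst"
    using K by (intro closed_map_fst) (simp add: compact_space_subtopology)
  ultimately have cl: "closedin U (fst ` ?C)" by (simp add: closed_map_def)
  have "w -` B \<inter> topspace U = topspace U - fst ` ?C"
  proof -
    have "w u x \<in> topspace Y" if "u \<in> topspace U" "x \<in> K" for u x
      using based[OF that(1)] KX that(2) by (auto simp: based_maps_def continuous_map_def)
    then show ?thesis using KX unfolding B by (auto simp: image_iff; blast)
  qed
  then show "openin U (w -` B \<inter> topspace U)" using cl by (simp add: openin_diff)
qed

text \<open>Regularity of a compact Hausdorff space puts a closed, hence compact, neighbourhood
  \<open>K\<close> of \<open>x\<close> inside the preimage of \<open>V\<close>; the condition that
  \<open>w u\<close> sends \<open>K\<close> into \<open>V\<close> is open in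
  \<open>u\<close>.\<close>

lemma continuous_map_from_mapspace:
  assumes X: "compact_space X" "Hausdorff_space X"
    and w: "continuous_map U (mapspace X x0 Y y0) w"
  shows "continuous_map (prod_topology U X) Y (\<lambda>(u, x). w u x)"
proof -
  have based: "w u \<in> based_maps X x0 Y y0" if "u \<in> topspace U" for u
    using that continuous_map_image_subset_topspace[OF w] by (auto simp: topspace_mapspace)
  have wc: "continuous_map X Y (w u)" if "u \<in> topspace U" for u
    using based[OF that] by (simp add: based_maps_def)
  have gen: "openin U {u \<in> topspace U. w u ` K \<subseteq> V}" if "compactin X K" "openin Y V" for K V
  proof -
    let ?T = "topology_generated_by {{f. f ` K \<subseteq> V} | K V. compactin X K \<and> openin Y V}"
    have "continuous_map U ?T w" using w by (simp add: mapspace_def continuous_map_in_subtopology)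
    moreover have "openin ?T {f. f ` K \<subseteq> V}" using that by (intro topology_generated_by_Basis) blast
    ultimately show ?thesis using openin_continuous_map_preimage by fastforce
  qed
  have reg: "neighbourhood_base_of (closedin X) X"
    using X compact_Hausdorff_imp_regular_space neighbourhood_base_of_closedin by blast
  show ?thesis
    unfolding continuous_map_def
  proof (intro conjI allI impI)
    show "(\<lambda>(u, x). w u x) \<in> topspace (prod_topology U X) \<rightarrow> topspace Y"
      using wc continuous_map_image_subset_topspace by fastforce
    fix V assume V: "openin Y V"
    let ?P = "{p \<in> topspace (prod_topology U X). (case p of (u, x) \<Rightarrow> w u x) \<in> V}"
    show "openin (prod_topology U X) ?P"
    proof (subst openin_subopen, intro ballI)
      fix p assume "p \<in> ?P"
      then obtain u x where p: "p = (u, x)" and u: "u \<in> topspace U" and x: "x \<in> topspace X" and wV: "w u x \<in> V"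
        by auto
      have "openin X {x \<in> topspace X. w u x \<in> V}"
        using wc[OF u] V by (rule openin_continuous_map_preimage)
      then obtain O' K where O': "openin X O'" and K: "closedin X K" and xO: "x \<in> O'" and OK: "O' \<subseteq> K"
        and KV: "K \<subseteq> {x \<in> topspace X. w u x \<in> V}"
        using reg x wV unfolding neighbourhood_base_of by (metis (mono_tags, lifting) mem_Collect_eq)
      have "compactin X K" using X(1) K by (rule closedin_compact_space)
      from gen[OF this V] have "openin (prod_topology U X) ({u \<in> topspace U. w u ` K \<subseteq> V} \<times> O')"
        using O' by (simp add: openin_prod_Times_iff)
      moreover have "p \<in> {u \<in> topspace U. w u ` K \<subseteq> V} \<times> O'" using p u xO KV by auto
      moreover have "{u \<in> topspace U. w u ` K \<subseteq> V} \<times> O' \<subseteq> ?P"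
        using OK openin_subset[OF O'] by auto
      ultimately show "\<exists>T. openin (prod_topology U X) T \<and> p \<in> T \<and> T \<subseteq> ?P" by blast
    qed
  qed
qed

text \<open>The exponential law with the unit interval as parameter space. It trades the path
  component in the definition of \<open>ssim\<close> for based homotopy.\<close>

lemma path_component_of_mapspace:
  assumes X: "compact_space X" "Hausdorff_space X" and x0: "x0 \<in> topspace X"
    and f: "f \<in> based_maps X x0 Y y0" and g: "g \<in> based_maps X x0 Y y0"
  shows "path_component_of (mapspace X x0 Y y0) f g \<longleftrightarrow> homotopic_with (\<lambda>h. h x0 = y0) X Y f g"
proof
  assume "path_component_of (mapspace X x0 Y y0) f g"
  then obtain p where p: "continuous_map (top_of_set {0..1}) (mapspace X x0 Y y0) p"
    and p01: "p 0 = f" "p (1::real) = g"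
    by (auto simp: path_component_of_def pathin_def)
  have "p t x0 = y0" if "t \<in> {0..1}" for t
    using continuous_map_image_subset_topspace[OF p] that by (auto simp: topspace_mapspace based_maps_def image_subset_iff)
  then show "homotopic_with (\<lambda>h. h x0 = y0) X Y f g"
    unfolding homotopic_with_def using continuous_map_from_mapspace[OF X p] p01
    by (intro exI[of _ "\<lambda>(t, x). p t x"]) auto
next
  assume "homotopic_with (\<lambda>h. h x0 = y0) X Y f g"
  then obtain h where h: "continuous_map (prod_topology (top_of_set {0..1::real}) X) Y h"
    and h01: "\<And>x. h (0, x) = f x" "\<And>x. h (1, x) = g x" and h0: "\<And>t. t \<in> {0..1} \<Longrightarrow> h (t, x0) = y0"
    unfolding homotopic_with_def by blast
  let ?p = "\<lambda>t. restrict (\<lambda>x. h (t, x)) (topspace X)"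
  have "continuous_map (top_of_set {0..1}) (mapspace X x0 Y y0) ?p"
  proof (rule continuous_map_into_mapspace)
    show "continuous_map (prod_topology (top_of_set {0..1}) X) Y (\<lambda>(t, x). ?p t x)"
      using h by (rule continuous_map_eq) auto
    fix t :: real assume t: "t \<in> topspace (top_of_set {0..1})"
    have "continuous_map X Y (h \<circ> Pair t)" using h t by (rule continuous_map_o_Pair)
    then have "continuous_map X Y (?p t)" by (rule continuous_map_eq) auto
    then show "?p t \<in> based_maps X x0 Y y0" using t x0 h0 by (auto simp: based_maps_def)
  qed
  moreover have "?p 0 = f" "?p 1 = g" using f g h01 by (auto simp: based_maps_def extensional_restrict)
  ultimately show "path_component_of (mapspace X x0 Y y0) f g"
    unfolding path_component_of_def pathin_def by blast
qed

text \<open>Working form of the condition on the maps in the support of \<open>S\<close>: continuity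
  into the mapping space becomes joint continuity on \<open>U \<times> X\<close>.\<close>

lemma umaps_path_component_mapspace:
  assumes X: "compact_space X" "Hausdorff_space X" and x0: "x0 \<in> topspace X"
    and a: "a \<in> based_maps X x0 Y y0"
  shows "w \<in> umaps U (subtopology (mapspace X x0 Y y0) (path_component_of_set (mapspace X x0 Y y0) a)) \<longleftrightarrow>
     w \<in> extensional (topspace U) \<and> continuous_map (prod_topology U X) Y (\<lambda>(u, x). w u x) \<and>
     (\<forall>u \<in> topspace U. w u \<in> based_maps X x0 Y y0 \<and> homotopic_with (\<lambda>h. h x0 = y0) X Y a (w u))"
proof -
  have "continuous_map U (mapspace X x0 Y y0) w \<longleftrightarrow>
      continuous_map (prod_topology U X) Y (\<lambda>(u, x). w u x) \<and> (\<forall>u \<in> topspace U. w u \<in> based_maps X x0 Y y0)"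
    using continuous_map_into_mapspace continuous_map_from_mapspace[OF X]
      continuous_map_image_subset_topspace topspace_mapspace by (metis image_subset_iff)
  then show ?thesis
    using path_component_of_mapspace[OF X x0 a] unfolding umaps_def continuous_map_in_subtopology by auto
qed

section \<open>Attaching a cell\<close>

text \<open>The preimage of a closed set is the union of a part closed in \<open>L\<close> and the
  \<open>\<phi>\<close>-image of a closed subset of \<open>D\<close>; the latter is closed because a
  map from a compact to a Hausdorff space is closed.\<close>

lemma continuous_map_from_closed_cover:
  assumes K: "Hausdorff_space K" and D: "compact_space D" and \<phi>: "continuous_map D K \<phi>"
    and L: "closedin K L" and cover: "topspace K = L \<union> \<phi> ` topspace D"
    and fL: "continuous_map (subtopology K L) Z f" and f\<phi>: "continuous_map D Z (f \<circ> \<phi>)"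
  shows "continuous_map K Z f"
  unfolding continuous_map_closedin
proof (intro conjI allI impI)
  have LK: "L \<subseteq> topspace K" using L by (rule closedin_subset)
  have "f y \<in> topspace Z" if "y \<in> topspace K" for y
    using that cover LK fL f\<phi> by (auto simp: continuous_map_def)
  then show "f \<in> topspace K \<rightarrow> topspace Z" by blast
  fix C assume C: "closedin Z C"
  have "closedin (subtopology K L) {y \<in> topspace (subtopology K L). f y \<in> C}"
    using fL C by (rule closedin_continuous_map_preimage)
  then have 1: "closedin K {y \<in> topspace (subtopology K L). f y \<in> C}"
    using L by (rule closedin_trans_full)
  have "closedin D {d \<in> topspace D. (f \<circ> \<phi>) d \<in> C}"
    using f\<phi> C by (rule closedin_continuous_map_preimage)
  moreover have "closed_map D K \<phi>" using D K \<phi> by (intro continuous_imp_closed_map)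
  ultimately have 2: "closedin K (\<phi> ` {d \<in> topspace D. (f \<circ> \<phi>) d \<in> C})" by (simp add: closed_map_def)
  have "{y \<in> topspace K. f y \<in> C}
      = {y \<in> topspace (subtopology K L). f y \<in> C} \<union> \<phi> ` {d \<in> topspace D. (f \<circ> \<phi>) d \<in> C}"
    using cover LK by auto
  then show "closedin K {y \<in> topspace K. f y \<in> C}" using 1 2 by (simp add: closedin_Un)
qed

section \<open>Closed disks in the space of real sequences\<close>

lemma disk_set_L2: "disk_set n = {x. L2_set x {..<n} \<le> 1 \<and> (\<forall>i\<ge>n. x i = 0)}"
  by (simp add: disk_set_def L2_set_def)

lemma ball_set_L2: "ball_set n = {x. L2_set x {..<n} < 1 \<and> (\<forall>i\<ge>n. x i = 0)}"
  by (simp add: ball_set_def L2_set_def)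

lemma disk_eq_top_of_set: "disk n = top_of_set (disk_set n)"
  by (simp add: disk_def euclidean_product_topology)

lemma topspace_disk [simp]: "topspace (disk n) = disk_set n"
  by (simp add: disk_eq_top_of_set)

lemma continuous_on_L2_set [continuous_intros]:
  fixes f :: "'x::topological_space \<Rightarrow> 'i \<Rightarrow> real"
  assumes "\<And>i. continuous_on S (\<lambda>x. f x i)"
  shows "continuous_on S (\<lambda>x. L2_set (f x) A)"
  unfolding L2_set_def using assms by (intro continuous_intros)

lemma compact_space_disk: "compact_space (disk n)"
proof -
  let ?P = "powertop_real (UNIV::nat set)"
  have "compactin ?P (PiE UNIV (\<lambda>_. {-1..1}))" by (simp add: compactin_PiE)
  moreover have "disk_set n \<subseteq> PiE UNIV (\<lambda>_. {-1..1})"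
  proof
    fix x assume x: "x \<in> disk_set n"
    have "\<bar>x i\<bar> \<le> 1" for i
    proof (cases "i < n")
      case True
      have "(x i)\<^sup>2 \<le> (\<Sum>i<n. (x i)\<^sup>2)" using True by (intro member_le_sum) auto
      also have "\<dots> \<le> 1" using x by (simp add: disk_set_def)
      finally show ?thesis by (simp add: abs_square_le_1)
    qed (use x in \<open>simp add: disk_set_def\<close>)
    then show "x \<in> PiE UNIV (\<lambda>_. {-1..1})" by (auto simp: abs_le_iff minus_le_iff)
  qed
  moreover have "closedin ?P (disk_set n)"
  proof -
    have "closed {x::nat \<Rightarrow> real. (\<Sum>i<n. (x i)\<^sup>2) \<le> 1}"
      by (intro closed_Collect_le continuous_intros continuous_on_product_coordinates)
    moreover have "closed {x::nat \<Rightarrow> real. \<forall>i. n \<le> i \<longrightarrow> x i = 0}"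
      by (intro closed_Collect_all closed_Collect_imp closed_Collect_eq continuous_intros
          continuous_on_product_coordinates) auto
    ultimately have "closed (disk_set n)" unfolding disk_set_def by (simp add: closed_Collect_conj)
    then show ?thesis by (simp add: euclidean_product_topology)
  qed
  ultimately have "compactin ?P (disk_set n)" by (rule closed_compactin)
  then show ?thesis by (simp add: disk_def compact_space_subtopology)
qed

locale cell_attachment =
  fixes K :: "'b topology" and L :: "'b set" and n :: nat and \<Phi> :: "(nat \<Rightarrow> real) \<Rightarrow> 'b"
  assumes Hausdorff: "Hausdorff_space K" and closedL: "closedin K L"
    and cont_char: "continuous_map (disk n) K \<Phi>"
    and homeo_char: "homeomorphic_map (subtopology (powertop_real UNIV) (ball_set n))
                       (subtopology K (topspace K - L)) \<Phi>"
    and char_boundary: "\<Phi> ` (disk_set n - ball_set n) \<subseteq> L"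
begin

abbreviation "cell \<equiv> topspace K - L"

definition coord :: "'b \<Rightarrow> nat \<Rightarrow> real" where "coord = inv_into (ball_set n) \<Phi>"

text \<open>The value 1 on \<open>L\<close> matches the norm on the boundary sphere, which
  \<open>\<Phi>\<close> sends into \<open>L\<close>; this makes the function continuous across the
  edge of the cell.\<close>

definition radius :: "'b \<Rightarrow> real" where
  "radius y = (if y \<in> L then 1 else L2_set (coord y) {..<n})"

text \<open>At time 1 the outer half of the cell has been pushed into \<open>L\<close>, where a homotopy is already
  available by induction.\<close>

definition expand :: "real \<times> 'b \<Rightarrow> 'b" where
  "expand = (\<lambda>(t, y). if y \<in> L then y
     else \<Phi> (\<lambda>i. coord y i / max (1 - t / 2) (L2_set (coord y) {..<n})))"

definition chord :: "real \<times> 'b \<times> 'b \<Rightarrow> 'b" where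
  "chord = (\<lambda>(t, y, y'). \<Phi> (\<lambda>i. (1 - t) * coord y i + t * coord y' i))"

lemma ball_subset_disk: "ball_set n \<subseteq> disk_set n"
  by (auto simp: ball_set_L2 disk_set_L2)

lemma char_image_ball: "\<Phi> ` ball_set n = cell"
  using homeomorphic_imp_surjective_map[OF homeo_char] by auto

lemma char_inj: "inj_on \<Phi> (ball_set n)"
  using homeomorphic_imp_injective_map[OF homeo_char] by simp

lemma coord_char: "w \<in> ball_set n \<Longrightarrow> coord (\<Phi> w) = w"
  unfolding coord_def by (rule inv_into_f_f[OF char_inj])

lemma char_coord: "y \<in> cell \<Longrightarrow> \<Phi> (coord y) = y"
  unfolding coord_def by (rule f_inv_into_f[of _ \<Phi> "ball_set n"]) (simp add: char_image_ball)

lemma coord_in_ball: "y \<in> cell \<Longrightarrow> coord y \<in> ball_set n"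
  unfolding coord_def by (rule inv_into_into) (simp add: char_image_ball)

lemma L_subset: "L \<subseteq> topspace K"
  using closedL by (rule closedin_subset)

lemma openin_cell: "openin K cell"
  using closedL by blast

lemma char_in: "w \<in> disk_set n \<Longrightarrow> \<Phi> w \<in> topspace K"
  using continuous_map_image_subset_topspace[OF cont_char] by auto

lemma char_in_L_iff: "w \<in> disk_set n \<Longrightarrow> \<Phi> w \<in> L \<longleftrightarrow> w \<notin> ball_set n"
  using char_boundary char_image_ball by blast

lemma cover: "topspace K = L \<union> \<Phi> ` disk_set n"
  using L_subset char_in ball_subset_disk char_image_ball by blast

lemma continuous_map_coord: "continuous_map (subtopology K cell) (top_of_set (ball_set n)) coord"
proof -
  obtain g where g: "homeomorphic_maps (subtopology (powertop_real UNIV) (ball_set n)) (subtopology K cell) \<Phi> g"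
    using homeo_char by (auto simp: homeomorphic_map_maps)
  then have "continuous_map (subtopology K cell) (subtopology (powertop_real UNIV) (ball_set n)) g"
    by (simp add: homeomorphic_maps_def)
  then show ?thesis
    unfolding euclidean_product_topology
  proof (rule continuous_map_eq)
    fix y assume "y \<in> topspace (subtopology K cell)"
    then have y: "y \<in> cell" by simp
    then have "g y = g (\<Phi> (coord y))" by (simp add: char_coord)
    also have "\<dots> = coord y" using g coord_in_ball[OF y] by (auto simp: homeomorphic_maps_def)
    finally show "g y = coord y" .
  qed
qed

lemma radius_char: "w \<in> disk_set n \<Longrightarrow> radius (\<Phi> w) = L2_set w {..<n}"
  using char_in_L_iff coord_char by (auto simp: radius_def disk_set_L2 ball_set_L2)

lemma radius_L [simp]: "y \<in> L \<Longrightarrow> radius y = 1"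
  by (simp add: radius_def)

lemma continuous_map_radius: "continuous_map K euclideanreal radius"
proof (rule continuous_map_from_closed_cover[OF Hausdorff compact_space_disk cont_char closedL])
  have "continuous_map (subtopology K L) euclideanreal (\<lambda>_. 1)" by simp
  then show "continuous_map (subtopology K L) euclideanreal radius" by (rule continuous_map_eq) simp
  have "continuous_map (disk n) euclideanreal (\<lambda>w. L2_set w {..<n})"
    unfolding disk_eq_top_of_set continuous_map_iff_continuous
    by (intro continuous_intros continuous_on_subset[OF continuous_on_product_coordinates subset_UNIV])
  then show "continuous_map (disk n) euclideanreal (radius \<circ> \<Phi>)"
    by (rule continuous_map_eq) (simp add: radius_char)
qed (simp add: cover)

lemma scaled_in_disk:
  assumes w: "w \<in> disk_set n" and t: "t \<in> {0..1}"
  shows "(\<lambda>i. w i / max (1 - t / 2) (L2_set w {..<n})) \<in> disk_set n" (is "?w' \<in> _")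
proof -
  let ?c = "max (1 - t / 2) (L2_set w {..<n})"
  have c: "?c > 0" "L2_set w {..<n} \<le> ?c" using t by auto
  have "L2_set ?w' {..<n} = L2_set (\<lambda>i. (1 / ?c) * w i) {..<n}" by simp
  also have "\<dots> = (1 / ?c) * L2_set w {..<n}" using c by (intro L2_set_right_distrib[symmetric]) auto
  also have "\<dots> \<le> 1" using c by (simp add: divide_le_eq_1)
  finally show ?thesis using w by (auto simp: disk_set_L2)
qed

text \<open>From norm \<open>1 - t / 2\<close> on, the maximum in the divisor is the norm itself, so
  the scaled point lies on the unit sphere.\<close>

lemma scaled_boundary:
  assumes w: "w \<in> disk_set n" and t: "1 - t / 2 \<le> L2_set w {..<n}" "t \<in> {0..1}"
  shows "(\<lambda>i. w i / max (1 - t / 2) (L2_set w {..<n})) \<notin> ball_set n" (is "?w' \<notin> _")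
proof -
  let ?c = "L2_set w {..<n}"
  have c: "?c > 0" using t by auto
  have "L2_set ?w' {..<n} = L2_set (\<lambda>i. (1 / ?c) * w i) {..<n}" using t by (simp add: max_absorb2)
  also have "\<dots> = (1 / ?c) * ?c" using c by (intro L2_set_right_distrib[symmetric]) auto
  finally show ?thesis using c by (simp add: ball_set_L2)
qed

lemma expand_L [simp]: "y \<in> L \<Longrightarrow> expand (t, y) = y"
  by (simp add: expand_def)

text \<open>On the boundary sphere the divisor is 1 and the formula gives \<open>\<Phi> w\<close>,
  in agreement with the clause of \<open>expand\<close> that fixes \<open>L\<close>. One formula
  thus covers the whole closed disk, as the continuity proof requires.\<close>

lemma expand_char:
  assumes w: "w \<in> disk_set n" and t: "t \<in> {0..1}"
  shows "expand (t, \<Phi> w) = \<Phi> (\<lambda>i. w i / max (1 - t / 2) (L2_set w {..<n}))"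
proof (cases "w \<in> ball_set n")
  case True
  then show ?thesis using char_in_L_iff[OF w] by (simp add: expand_def coord_char)
next
  case False
  then have "L2_set w {..<n} = 1" using w by (auto simp: disk_set_L2 ball_set_L2)
  then show ?thesis using False char_in_L_iff[OF w] t by (simp add: max_def)
qed

lemma expand_0: "y \<in> topspace K \<Longrightarrow> expand (0, y) = y"
proof (cases "y \<in> L")
  case False
  assume "y \<in> topspace K"
  then have y: "y \<in> cell" using False by simp
  then have "L2_set (coord y) {..<n} < 1" using coord_in_ball by (auto simp: ball_set_L2)
  then show ?thesis using False char_coord[OF y] by (simp add: expand_def max_def)
qed simp

lemma continuous_map_expand: "continuous_map (prod_topology (top_of_set {0..1}) K) K expand"
proof (rule continuous_map_from_closed_cover)
  let ?I = "top_of_set {0..1::real}"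
  show "Hausdorff_space (prod_topology ?I K)"
    using Hausdorff by (simp add: Hausdorff_space_prod_topology Hausdorff_space_subtopology)
  show "compact_space (prod_topology ?I (disk n))"
    by (simp add: compact_space_prod_topology compact_space_disk compact_space_subtopology)
  show "continuous_map (prod_topology ?I (disk n)) (prod_topology ?I K) (\<lambda>(t, w). (t, \<Phi> w))"
    using cont_char by (simp add: continuous_map_prod_top)
  show "closedin (prod_topology ?I K) ({0..1} \<times> L)"
    using closedL by (simp add: closedin_prod_Times_iff closedin_subtopology_refl)
  show "topspace (prod_topology ?I K) = {0..1} \<times> L \<union> (\<lambda>(t, w). (t, \<Phi> w)) ` topspace (prod_topology ?I (disk n))"
    using cover by (auto simp: image_iff)
  have "continuous_map (subtopology (prod_topology ?I K) ({0..1} \<times> L)) K snd"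
    by (intro continuous_map_from_subtopology continuous_map_snd)
  then show "continuous_map (subtopology (prod_topology ?I K) ({0..1} \<times> L)) K expand"
    by (rule continuous_map_eq) auto
  have "continuous_on ({0..1} \<times> disk_set n) (\<lambda>(t, w) i. w i / max (1 - t / 2) (L2_set w {..<n}))"
    unfolding split_beta
    by (intro continuous_intros continuous_on_coordinatewise_then_product continuous_on_product_then_coordinatewise) auto
  then have "continuous_map (prod_topology ?I (disk n)) (disk n)
      (\<lambda>(t, w) i. w i / max (1 - t / 2) (L2_set w {..<n}))"
    using scaled_in_disk
    by (auto simp: disk_eq_top_of_set continuous_map_in_subtopology prod_topology_subtopology_eu)
  then have "continuous_map (prod_topology ?I (disk n)) K
      (\<Phi> \<circ> (\<lambda>(t, w) i. w i / max (1 - t / 2) (L2_set w {..<n})))"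
    using cont_char by (rule continuous_map_compose)
  then show "continuous_map (prod_topology ?I (disk n)) K (expand \<circ> (\<lambda>(t, w). (t, \<Phi> w)))"
    by (rule continuous_map_eq) (auto simp: expand_char)
qed

lemma expand_1_in_L:
  assumes y: "y \<in> topspace K" and r: "1/2 \<le> radius y"
  shows "expand (1, y) \<in> L"
proof (cases "y \<in> L")
  case False
  with y have yc: "y \<in> cell" by simp
  then have w: "coord y \<in> disk_set n" using coord_in_ball ball_subset_disk by blast
  have "expand (1, y) = \<Phi> (\<lambda>i. coord y i / max (1 - 1 / 2) (L2_set (coord y) {..<n}))"
    using expand_char[OF w, of 1] char_coord[OF yc] by simp
  moreover have "\<dots> \<in> L"
    using False r scaled_in_disk[OF w, of 1] scaled_boundary[OF w, of 1]
    by (subst char_in_L_iff) (auto simp: radius_def)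
  ultimately show ?thesis by simp
qed simp

lemma segment_in_ball:
  assumes w: "w \<in> ball_set n" "w' \<in> ball_set n" and t: "t \<in> {0..1}"
  shows "(\<lambda>i. (1 - t) * w i + t * w' i) \<in> ball_set n"
proof -
  have "L2_set (\<lambda>i. (1 - t) * w i + t * w' i) {..<n}
      \<le> L2_set (\<lambda>i. (1 - t) * w i) {..<n} + L2_set (\<lambda>i. t * w' i) {..<n}"
    by (rule L2_set_triangle_ineq)
  also have "\<dots> = (1 - t) * L2_set w {..<n} + t * L2_set w' {..<n}"
    using t by (simp add: L2_set_right_distrib)
  also have "\<dots> < 1"
    using w t by (intro convex_bound_lt) (auto simp: ball_set_L2)
  finally show ?thesis using w by (simp add: ball_set_L2)
qed

lemma chord_in_cell:
  assumes "y \<in> cell" "y' \<in> cell" "t \<in> {0..1}"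
  shows "chord (t, y, y') \<in> cell"
  using segment_in_ball[OF coord_in_ball coord_in_ball, OF assms] char_image_ball
  by (auto simp: chord_def)

lemma chord_ends:
  assumes "y \<in> cell" "y' \<in> cell"
  shows "chord (0, y, y') = y" "chord (1, y, y') = y'"
  using assms char_coord by (simp_all add: chord_def)

lemma chord_same: "y \<in> cell \<Longrightarrow> chord (t, y, y) = y"
  using char_coord by (simp add: chord_def flip: distrib_right)

lemma continuous_map_chord:
  assumes "continuous_map T (top_of_set {0..1}) \<tau>" "continuous_map T K \<alpha>" "continuous_map T K \<beta>"
    and cell: "\<And>q. q \<in> topspace T \<Longrightarrow> \<alpha> q \<in> cell" "\<And>q. q \<in> topspace T \<Longrightarrow> \<beta> q \<in> cell"
  shows "continuous_map T K (\<lambda>q. chord (\<tau> q, \<alpha> q, \<beta> q))"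
proof -
  let ?m = "\<lambda>q i. (1 - \<tau> q) * coord (\<alpha> q) i + \<tau> q * coord (\<beta> q) i"
  have coord: "continuous_map T euclideanreal (\<lambda>q. coord (\<gamma> q) i)"
    if "continuous_map T K \<gamma>" "\<And>q. q \<in> topspace T \<Longrightarrow> \<gamma> q \<in> cell" for \<gamma> i
  proof -
    have "continuous_map T (subtopology K cell) \<gamma>" using that by (auto simp: continuous_map_in_subtopology)
    then have "continuous_map T (top_of_set (ball_set n)) (coord \<circ> \<gamma>)"
      using continuous_map_coord by (rule continuous_map_compose)
    moreover have "continuous_map (top_of_set (ball_set n)) euclideanreal (\<lambda>w. w i)"
      unfolding continuous_map_iff_continuous
      by (rule continuous_on_subset[OF continuous_on_product_coordinates subset_UNIV])
    ultimately have "continuous_map T euclideanreal ((\<lambda>w. w i) \<circ> (coord \<circ> \<gamma>))"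
      by (rule continuous_map_compose)
    then show ?thesis by (simp add: o_def)
  qed
  have \<tau>: "continuous_map T euclideanreal \<tau>" "\<And>q. q \<in> topspace T \<Longrightarrow> \<tau> q \<in> {0..1}"
    using assms(1) by (auto simp: continuous_map_in_subtopology)
  have "continuous_map T (powertop_real UNIV) ?m"
    using \<tau> assms(2,3) cell coord
    by (auto simp: continuous_map_componentwise_UNIV intro!: continuous_intros)
  then have "continuous_map T (disk n) ?m"
    unfolding disk_def continuous_map_in_subtopology
    using segment_in_ball[OF coord_in_ball coord_in_ball, OF cell \<tau>(2)] ball_subset_disk by blast
  then have "continuous_map T K (\<Phi> \<circ> ?m)" using cont_char by (rule continuous_map_compose)
  then show ?thesis by (simp add: chord_def o_def)
qed

end

text \<open>Near the diagonal of \<open>K \<times> K\<close> the two projections are homotopic: a weak form of local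
  equiconnectedness, in which the homotopy need not be stationary on the diagonal.\<close>

definition diag_planner :: "'b topology \<Rightarrow> 'b \<Rightarrow> bool" where
  "diag_planner K y0 \<longleftrightarrow> (\<exists>N. openin (prod_topology K K) N \<and> (\<forall>y \<in> topspace K. (y, y) \<in> N) \<and>
     homotopic_with (\<lambda>h. h (y0, y0) = y0) (subtopology (prod_topology K K) N) K fst snd)"

lemma homotopic_with_basepoint_intro:
  assumes "p \<in> topspace T" "continuous_map (prod_topology (top_of_set {0..1::real}) T) K h"
    "\<And>q. q \<in> topspace T \<Longrightarrow> h (0, q) = f q" "\<And>q. q \<in> topspace T \<Longrightarrow> h (1, q) = g q"
    "\<And>t. t \<in> {0..1} \<Longrightarrow> h (t, p) = y"
  shows "homotopic_with (\<lambda>h. h p = y) T K f g"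
  using assms by (subst homotopic_with) auto

section \<open>Extending a diagonal planner over one attached cell\<close>

context cell_attachment
begin

lemma continuous_map_expand_comp:
  assumes "continuous_map T (top_of_set {0..1}) \<tau>" "continuous_map T K \<alpha>"
  shows "continuous_map T K (\<lambda>q. expand (\<tau> q, \<alpha> q))"
proof -
  have "continuous_map T (prod_topology (top_of_set {0..1}) K) (\<lambda>q. (\<tau> q, \<alpha> q))"
    using assms by (simp add: continuous_map_pairwise o_def)
  from continuous_map_compose[OF this continuous_map_expand] show ?thesis by (simp add: o_def)
qed

text \<open>At radius above 1/2 the expansion moves points into \<open>L\<close>, where the given
  homotopy \<open>G\<close> applies; deep in the cell two points are joined by the chord in disk
  coordinates. The work lies in changing recipe across a collar, and in taking \<open>N\<close> so
  small that each recipe is available where it is used.\<close>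

lemma diag_planner_attach:
  assumes y0: "y0 \<in> L" and planL: "diag_planner (subtopology K L) y0"
  shows "diag_planner K y0"
proof -
  let ?I = "top_of_set {0..1::real}"
  let ?KK = "prod_topology K K"
  let ?LL = "prod_topology (subtopology K L) (subtopology K L)"
  obtain NL where NL: "openin ?LL NL" "\<And>y. y \<in> L \<Longrightarrow> (y, y) \<in> NL"
    and hom: "homotopic_with (\<lambda>h. h (y0, y0) = y0) (subtopology ?LL NL) (subtopology K L) fst snd"
    using planL L_subset unfolding diag_planner_def by (auto simp: inf.absorb2)
  have NL_sub: "NL \<subseteq> L \<times> L" using openin_subset[OF NL(1)] by auto
  obtain G where G: "continuous_map (prod_topology ?I (subtopology ?LL NL)) (subtopology K L) G"
    and G0: "\<And>p. G (0, p) = fst p" and G1: "\<And>p. G (1, p) = snd p"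
    and Gb: "\<And>t. t \<in> {0..1} \<Longrightarrow> G (t, (y0, y0)) = y0"
    using hom unfolding homotopic_with_def by auto
  have G_comp: "continuous_map T K (\<lambda>q. G (\<tau> q, (\<alpha> q, \<beta> q)))"
    if "continuous_map T ?I \<tau>" "continuous_map T K \<alpha>" "continuous_map T K \<beta>"
      and in_NL: "\<And>q. q \<in> topspace T \<Longrightarrow> (\<alpha> q, \<beta> q) \<in> NL" for T :: "'z topology" and \<tau> \<alpha> \<beta>
  proof -
    have "\<alpha> q \<in> L" "\<beta> q \<in> L" if "q \<in> topspace T" for q using in_NL[OF that] NL_sub by auto
    then have "continuous_map T (prod_topology ?I (subtopology ?LL NL)) (\<lambda>q. (\<tau> q, (\<alpha> q, \<beta> q)))"
      using that in_NL by (auto simp: continuous_map_pairwise continuous_map_in_subtopology o_def)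
    then have "continuous_map T (subtopology K L) (G \<circ> (\<lambda>q. (\<tau> q, (\<alpha> q, \<beta> q))))"
      using G by (rule continuous_map_compose)
    then show ?thesis by (simp add: continuous_map_in_subtopology o_def)
  qed
  \<comment> \<open>The map \<open>r\<close> sends radius at least 1/2 into \<open>L\<close> and is
    homotopic to the identity through \<open>expand\<close>, so it suffices to join
    \<open>r y\<close> to \<open>r y'\<close>.\<close>
  define r where "r = (\<lambda>y. expand (1, y))"
  have r_cont: "continuous_map K K r"
    unfolding r_def by (rule continuous_map_expand_comp) auto
  have r_comp: "continuous_map T K (\<lambda>q. r (\<alpha> q))" if "continuous_map T K \<alpha>" for T :: "'z topology" and \<alpha>
    using continuous_map_compose[OF that r_cont] by (simp add: o_def)
  have rL: "r y \<in> L" if "y \<in> topspace K" "1/2 \<le> radius y" for y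
    using expand_1_in_L[OF that] by (simp add: r_def)
  have r_y0: "r y0 = y0" using y0 by (simp add: r_def)
  define W1 where "W1 = {p \<in> topspace ?KK. 1/2 < radius (fst p) \<and> 1/2 < radius (snd p) \<and> (r (fst p), r (snd p)) \<in> NL}"
  have W1: "openin ?KK W1"
  proof -
    let ?O = "{y \<in> topspace K. radius y \<in> {1/2<..}}"
    have O: "openin K ?O" using continuous_map_radius by (rule openin_continuous_map_preimage) simp
    then have OO: "openin ?KK (?O \<times> ?O)" by (simp add: openin_prod_Times_iff)
    have "continuous_map (subtopology ?KK (?O \<times> ?O)) ?LL (\<lambda>p. (r (fst p), r (snd p)))"
      using rL by (auto simp: continuous_map_pairwise continuous_map_in_subtopology o_def
          intro!: r_comp continuous_map_from_subtopology continuous_map_fst continuous_map_snd)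
    then have "openin (subtopology ?KK (?O \<times> ?O))
        {p \<in> topspace (subtopology ?KK (?O \<times> ?O)). (r (fst p), r (snd p)) \<in> NL}"
      using NL(1) by (rule openin_continuous_map_preimage)
    then have "openin ?KK {p \<in> topspace (subtopology ?KK (?O \<times> ?O)). (r (fst p), r (snd p)) \<in> NL}"
      using OO by (rule openin_trans_full)
    moreover have "{p \<in> topspace (subtopology ?KK (?O \<times> ?O)). (r (fst p), r (snd p)) \<in> NL} = W1"
      by (auto simp: W1_def)
    ultimately show ?thesis by simp
  qed
  have cc: "openin ?KK (cell \<times> cell)" using openin_cell by (simp add: openin_prod_Times_iff)
  \<comment> \<open>In the collar the second argument of \<open>G\<close> will follow the image
    under \<open>r\<close> of the chord, so every intermediate pair must already lie in
    \<open>W1\<close>.\<close>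
  define W2 where "W2 = {p \<in> cell \<times> cell. \<forall>t \<in> {0..1}. (fst p, chord (t, p)) \<in> W1}"
  have W2: "openin ?KK W2"
  proof -
    let ?C = "subtopology ?KK (cell \<times> cell)"
    have C: "topspace ?C = cell \<times> cell" by auto
    let ?T = "prod_topology ?I ?C"
    have fst_c: "continuous_map ?T K (\<lambda>q. fst (snd q))" and snd_c: "continuous_map ?T K (\<lambda>q. snd (snd q))"
      by (intro continuous_map_fst_of[unfolded o_def] continuous_map_snd_of[unfolded o_def]
          continuous_map_compose[OF continuous_map_snd, unfolded o_def] continuous_map_from_subtopology
          continuous_map_fst continuous_map_snd)+
    have "continuous_map ?T K (\<lambda>q. chord (fst q, fst (snd q), snd (snd q)))"
      by (rule continuous_map_chord[OF continuous_map_fst fst_c snd_c]) (simp_all add: C mem_Times_iff)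
    then have "continuous_map ?T ?KK (\<lambda>q. (fst (snd q), chord (fst q, fst (snd q), snd (snd q))))"
      using fst_c by (simp add: continuous_map_pairwise o_def)
    then have cm: "continuous_map ?T ?KK (\<lambda>q. (fst (snd q), chord q))" by simp
    \<comment> \<open>A tube argument again: the pairs with a bad time are the projection of a
      closed set along the compact interval.\<close>
    have "closedin ?T {q \<in> topspace ?T. (fst (snd q), chord q) \<in> topspace ?KK - W1}"
      by (rule closedin_continuous_map_preimage[OF cm]) (use W1 in blast)
    moreover have "closed_map ?T ?C snd"
      by (rule closed_map_snd) (simp add: compact_space_subtopology)
    ultimately have "closedin ?C (snd ` {q \<in> topspace ?T. (fst (snd q), chord q) \<in> topspace ?KK - W1})"
      by (simp only: closed_map_def)
    then have "openin ?C (topspace ?C - snd ` {q \<in> topspace ?T. (fst (snd q), chord q) \<in> topspace ?KK - W1})"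
      by blast
    moreover have "topspace ?C - snd ` {q \<in> topspace ?T. (fst (snd q), chord q) \<in> topspace ?KK - W1} = W2"
      (is "?l = _")
    proof
      show "?l \<subseteq> W2"
      proof
        fix p assume p: "p \<in> ?l"
        then have pc: "p \<in> cell \<times> cell" using C by blast
        have "(fst p, chord (t, p)) \<in> W1" if t: "t \<in> {0..1}" for t
        proof (rule ccontr)
          assume n: "(fst p, chord (t, p)) \<notin> W1"
          have "chord (t, fst p, snd p) \<in> cell" using pc t by (intro chord_in_cell) auto
          then have "(fst p, chord (t, p)) \<in> topspace ?KK - W1" using n pc by auto
          moreover have "(t, p) \<in> topspace ?T" using t pc by auto
          ultimately have "(t, p) \<in> {q \<in> topspace ?T. (fst (snd q), chord q) \<in> topspace ?KK - W1}" by simp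
          then show False using p by force
        qed
        then show "p \<in> W2" using pc by (simp add: W2_def)
      qed
      show "W2 \<subseteq> ?l" by (auto simp: W2_def)
    qed
    ultimately have "openin ?C W2" by simp
    then show ?thesis using cc by (rule openin_trans_full)
  qed
  \<comment> \<open>The thresholds 5/8 and 3/4 are arbitrary numbers between 1/2 and 1.
    \<open>W3\<close> stops strictly below 5/8 and \<open>W4\<close> starts strictly above 3/4, so
    on the closed collar between them a pair in \<open>N\<close> must lie in
    \<open>W1 \<inter> W2\<close>, where both recipes work.\<close>
  define W3 where "W3 = {p \<in> cell \<times> cell. radius (fst p) < 5/8}"
  define W4 where "W4 = {p \<in> topspace ?KK. 3/4 < radius (fst p)}"
  have rad_fst: "continuous_map ?KK euclideanreal (\<lambda>p. radius (fst p))"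
    using continuous_map_compose[OF continuous_map_fst continuous_map_radius] by (simp add: o_def)
  have W3: "openin ?KK W3"
  proof -
    have "openin ?KK {p \<in> topspace ?KK. radius (fst p) \<in> {..<5/8}}"
      using rad_fst by (rule openin_continuous_map_preimage) simp
    then have "openin ?KK ({p \<in> topspace ?KK. radius (fst p) \<in> {..<5/8}} \<inter> cell \<times> cell)"
      using cc by (rule openin_Int)
    moreover have "{p \<in> topspace ?KK. radius (fst p) \<in> {..<5/8}} \<inter> cell \<times> cell = W3" by (auto simp: W3_def)
    ultimately show ?thesis by simp
  qed
  have W4: "openin ?KK W4"
  proof -
    have "openin ?KK {p \<in> topspace ?KK. radius (fst p) \<in> {3/4<..}}"
      using rad_fst by (rule openin_continuous_map_preimage) simp
    then show ?thesis by (simp add: W4_def)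
  qed
  define N where "N = W3 \<union> (W1 \<inter> W4) \<union> (W1 \<inter> W2)"
  have N: "openin ?KK N" using W1 W2 W3 W4 by (simp add: N_def openin_Un openin_Int)
  have N_sub: "N \<subseteq> topspace K \<times> topspace K" using openin_subset[OF N] by simp
  have N_diag: "(y, y) \<in> N" if y: "y \<in> topspace K" for y
  proof -
    have 1: "(y, y) \<in> W1" if "1/2 < radius y"
      using that y NL(2) rL by (simp add: W1_def)
    consider "radius y < 5/8" | "3/4 < radius y" | "5/8 \<le> radius y" "radius y \<le> 3/4" by linarith
    then show ?thesis
    proof cases
      case 1
      then have "y \<notin> L" by auto
      then show ?thesis using 1 y by (simp add: N_def W3_def)
    next
      case 2
      then show ?thesis using 1 y by (simp add: N_def W4_def)
    next
      case 3
      then have "y \<notin> L" by auto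
      then have "y \<in> cell" using y by simp
      then have "(y, y) \<in> W2" using 1 3 chord_same by (simp add: W2_def)
      then show ?thesis using 1 3 by (simp add: N_def)
    qed
  qed
  have N_low: "y \<in> cell \<and> y' \<in> cell" if "(y, y') \<in> N" "radius y \<le> 3/4" for y y'
    using that by (auto simp: N_def W2_def W3_def W4_def)
  have N_W1: "(y, y') \<in> W1" if "(y, y') \<in> N" "5/8 \<le> radius y" for y y'
    using that by (auto simp: N_def W3_def)
  have N_mid: "(y, chord (t, y, y')) \<in> W1" if "(y, y') \<in> N" "5/8 \<le> radius y" "radius y \<le> 3/4" "t \<in> {0..1}" for y y' t
    using that by (auto simp: N_def W2_def W3_def W4_def)
  let ?TN = "subtopology ?KK N"
  let ?T = "prod_topology ?I ?TN"
  have TN: "topspace ?TN = N" using N_sub by auto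
  have y0N: "(y0, y0) \<in> topspace ?TN" using N_diag y0 L_subset TN by auto
  have ct: "continuous_map ?T ?I fst" by (rule continuous_map_fst)
  have cy: "continuous_map ?T K (\<lambda>q. fst (snd q))" and cy': "continuous_map ?T K (\<lambda>q. snd (snd q))"
    by (intro continuous_map_compose[OF continuous_map_snd, unfolded o_def] continuous_map_from_subtopology
          continuous_map_fst continuous_map_snd)+
  have crad: "continuous_map ?T euclideanreal (\<lambda>q. radius (fst (snd q)))"
    using continuous_map_compose[OF cy continuous_map_radius] by (simp add: o_def)
  \<comment> \<open>The affine function \<open>8 * radius y - 5\<close> is 0 at radius 5/8 and 1 at
    radius 3/4; clamping makes \<open>u\<close> constant outside the collar.\<close>
  define u where "u = (\<lambda>y. min 1 (max 0 (8 * radius y - 5)))"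
  have u01: "u y \<in> {0..1}" for y by (auto simp: u_def)
  have u_low: "u y = 0" if "radius y \<le> 5/8" for y using that by (simp add: u_def)
  have u_high: "u y = 1" if "3/4 \<le> radius y" for y using that by (simp add: u_def)
  have cu: "continuous_map ?T euclideanreal (\<lambda>q. u (fst (snd q)))"
    unfolding u_def using crad by (intro continuous_intros)
  have ctr: "continuous_map ?T euclideanreal fst" using ct by (simp add: continuous_map_in_subtopology)
  have rfst: "homotopic_with (\<lambda>h. h (y0, y0) = y0) ?TN K fst (\<lambda>p. r (fst p))"
    using y0 N_sub TN
    by (intro homotopic_with_basepoint_intro[OF y0N continuous_map_expand_comp[OF ct cy]])
       (auto simp: expand_0 r_def)
  have rsnd: "homotopic_with (\<lambda>h. h (y0, y0) = y0) ?TN K snd (\<lambda>p. r (snd p))"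
    using y0 N_sub TN
    by (intro homotopic_with_basepoint_intro[OF y0N continuous_map_expand_comp[OF ct cy']])
       (auto simp: expand_0 r_def)
  txt \<open>On the collar \<open>5/8 \<le> radius \<le> 3/4\<close> the parameter \<open>u\<close> interpolates between the chord inside
    the cell (\<open>u = 0\<close>) and the path \<open>G\<close> in \<open>L\<close> (\<open>u = 1\<close>). As \<open>G\<close> need not be stationary on the diagonal,
    the loop \<open>G (_, (r y, r y))\<close> is first run backwards to cancel its contribution.\<close>
  define h1 where "h1 = (\<lambda>q :: real \<times> 'b \<times> 'b. if radius (fst (snd q)) \<le> 5/8 then r (fst (snd q))
      else G (1 - fst q * u (fst (snd q)), (r (fst (snd q)), r (fst (snd q)))))"
  define h2 where "h2 = (\<lambda>q :: real \<times> 'b \<times> 'b. if radius (fst (snd q)) \<le> 5/8 then r (chord q)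
      else if radius (fst (snd q)) \<le> 3/4 then G (1 - u (fst (snd q)), (r (fst (snd q)), r (chord q)))
      else r (fst (snd q)))"
  define h3 where "h3 = (\<lambda>q :: real \<times> 'b \<times> 'b. if radius (fst (snd q)) \<le> 5/8 then r (snd (snd q))
      else G (1 - u (fst (snd q)) + fst q * u (fst (snd q)), (r (fst (snd q)), r (snd (snd q)))))"
  have tu: "1 - t * v \<in> {0..1}" "1 - v + t * v \<in> {0..1}" if "t \<in> {0..1}" "v \<in> {0..1}" for t v :: real
  proof -
    have "0 \<le> t * v" "t * v \<le> v" using that by (auto intro: mult_left_le_one_le)
    then show "1 - t * v \<in> {0..1}" "1 - v + t * v \<in> {0..1}" using that by auto
  qed
  have mem: "fst q \<in> {0..1} \<and> snd q \<in> N \<and> (fst (snd q), snd (snd q)) \<in> N"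
    if "q \<in> topspace ?T" for q using that TN by auto
  have sub: "continuous_map (subtopology ?T S) Z f" if "continuous_map ?T Z f" for S and Z :: "'z topology" and f
    using that by (rule continuous_map_from_subtopology)
  have into_I: "continuous_map ?T ?I f"
    if "continuous_map ?T euclideanreal f" "\<And>q. q \<in> topspace ?T \<Longrightarrow> f q \<in> {0..1}" for f
    unfolding continuous_map_in_subtopology using that by blast
  have c1: "continuous_map ?T K h1"
    unfolding h1_def
  proof (rule continuous_map_cases_le[OF crad])
    let ?S = "{q. q \<in> topspace ?T \<and> 5/8 \<le> radius (fst (snd q))}"
    show "continuous_map (subtopology ?T {q. q \<in> topspace ?T \<and> radius (fst (snd q)) \<le> 5/8}) K (\<lambda>q. r (fst (snd q)))"
      by (intro sub r_comp cy)
    show "continuous_map (subtopology ?T ?S) K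
        (\<lambda>q. G (1 - fst q * u (fst (snd q)), (r (fst (snd q)), r (fst (snd q)))))"
    proof (rule G_comp)
      have "continuous_map ?T ?I (\<lambda>q. 1 - fst q * u (fst (snd q)))"
        by (rule into_I) (intro continuous_intros ctr cu, use tu(1)[OF _ u01] mem in blast)
      then show "continuous_map (subtopology ?T ?S) ?I (\<lambda>q. 1 - fst q * u (fst (snd q)))" by (rule sub)
      show "continuous_map (subtopology ?T ?S) K (\<lambda>q. r (fst (snd q)))"
        "continuous_map (subtopology ?T ?S) K (\<lambda>q. r (fst (snd q)))"
        by (intro sub r_comp cy)+
      fix q assume "q \<in> topspace (subtopology ?T ?S)"
      then show "(r (fst (snd q)), r (fst (snd q))) \<in> NL"
        using mem[of q] N_sub by (intro NL(2) rL) auto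
    qed
  \<comment> \<open>At radius 5/8, \<open>u\<close> vanishes and \<open>G\<close> at time 1 is the
    second projection, so the branches agree.\<close>
  qed (auto simp: u_low G1)
  have c3: "continuous_map ?T K h3"
    unfolding h3_def
  proof (rule continuous_map_cases_le[OF crad])
    let ?S = "{q. q \<in> topspace ?T \<and> 5/8 \<le> radius (fst (snd q))}"
    show "continuous_map (subtopology ?T {q. q \<in> topspace ?T \<and> radius (fst (snd q)) \<le> 5/8}) K (\<lambda>q. r (snd (snd q)))"
      by (intro sub r_comp cy')
    show "continuous_map (subtopology ?T ?S) K
        (\<lambda>q. G (1 - u (fst (snd q)) + fst q * u (fst (snd q)), (r (fst (snd q)), r (snd (snd q)))))"
    proof (rule G_comp)
      have "continuous_map ?T ?I (\<lambda>q. 1 - u (fst (snd q)) + fst q * u (fst (snd q)))"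
        by (rule into_I) (intro continuous_intros ctr cu, use tu(2)[OF _ u01] mem in blast)
      then show "continuous_map (subtopology ?T ?S) ?I (\<lambda>q. 1 - u (fst (snd q)) + fst q * u (fst (snd q)))" by (rule sub)
      show "continuous_map (subtopology ?T ?S) K (\<lambda>q. r (fst (snd q)))" by (intro sub r_comp cy)
      show "continuous_map (subtopology ?T ?S) K (\<lambda>q. r (snd (snd q)))" by (intro sub r_comp cy')
      fix q assume "q \<in> topspace (subtopology ?T ?S)"
      then show "(r (fst (snd q)), r (snd (snd q))) \<in> NL"
        using mem[of q] N_W1[of "fst (snd q)" "snd (snd q)"] by (simp add: W1_def)
    qed
  qed (auto simp: u_low G1)
  have c2: "continuous_map ?T K h2"
    unfolding h2_def
  proof (rule continuous_map_cases_le[OF crad])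
    let ?Slow = "{q. q \<in> topspace ?T \<and> radius (fst (snd q)) \<le> 5/8}"
    let ?S = "{q. q \<in> topspace ?T \<and> 5/8 \<le> radius (fst (snd q))}"
    let ?TS = "subtopology ?T ?S"
    let ?S' = "{q. q \<in> topspace ?TS \<and> radius (fst (snd q)) \<le> 3/4}"
    have chord_c: "continuous_map (subtopology ?T R) K chord"
      if "\<And>q. q \<in> topspace ?T \<Longrightarrow> q \<in> R \<Longrightarrow> radius (fst (snd q)) \<le> 3/4" for R
    proof -
      have "continuous_map (subtopology ?T R) K (\<lambda>q. chord (fst q, fst (snd q), snd (snd q)))"
      proof (intro continuous_map_chord sub ct cy cy')
        fix q assume "q \<in> topspace (subtopology ?T R)"
        then have q: "q \<in> topspace ?T" and "q \<in> R" by simp_all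
        then have "radius (fst (snd q)) \<le> 3/4" by (rule that)
        moreover have "(fst (snd q), snd (snd q)) \<in> N" using mem[OF q] by blast
        ultimately show "fst (snd q) \<in> cell" "snd (snd q) \<in> cell" using N_low by blast+
      qed
      then show ?thesis by simp
    qed
    show "continuous_map (subtopology ?T ?Slow) K (\<lambda>q. r (chord q))"
      by (intro r_comp chord_c) auto
    show "continuous_map ?TS K (\<lambda>q. if radius (fst (snd q)) \<le> 3/4
        then G (1 - u (fst (snd q)), (r (fst (snd q)), r (chord q))) else r (fst (snd q)))"
    proof (rule continuous_map_cases_le[OF sub[OF crad]])
      have eq: "subtopology ?TS ?S' = subtopology ?T (?S \<inter> ?S')" by (rule subtopology_subtopology)
      show "continuous_map (subtopology ?TS ?S') K (\<lambda>q. G (1 - u (fst (snd q)), (r (fst (snd q)), r (chord q))))"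
        unfolding eq
      proof (rule G_comp)
        have "continuous_map ?T ?I (\<lambda>q. 1 - u (fst (snd q)))"
          by (rule into_I) (intro continuous_intros cu, use u01 in auto)
        then show "continuous_map (subtopology ?T (?S \<inter> ?S')) ?I (\<lambda>q. 1 - u (fst (snd q)))" by (rule sub)
        show "continuous_map (subtopology ?T (?S \<inter> ?S')) K (\<lambda>q. r (fst (snd q)))" by (intro sub r_comp cy)
        show "continuous_map (subtopology ?T (?S \<inter> ?S')) K (\<lambda>q. r (chord q))"
          by (intro r_comp chord_c) auto
        fix q assume "q \<in> topspace (subtopology ?T (?S \<inter> ?S'))"
        then show "(r (fst (snd q)), r (chord q)) \<in> NL"
          using mem[of q] N_mid[of "fst (snd q)" "snd (snd q)" "fst q"] by (simp add: W1_def)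
      qed
      show "continuous_map (subtopology ?TS {q. q \<in> topspace ?TS \<and> 3/4 \<le> radius (fst (snd q))}) K (\<lambda>q. r (fst (snd q)))"
        by (intro continuous_map_from_subtopology sub r_comp cy)
    \<comment> \<open>At radius 3/4, \<open>u\<close> is 1 and \<open>G\<close> at time 0 is the
      first projection, so the chord drops out. This is essential, because beyond the collar the
      second point may lie in \<open>L\<close>, where there is no chord.\<close>
    qed (auto simp: u_high G0)
  qed (auto simp: u_low G1)
  have 1: "homotopic_with (\<lambda>h. h (y0, y0) = y0) ?TN K (\<lambda>p. r (fst p)) (\<lambda>p. h1 (1, p))"
    using y0 tu(1)[OF _ u01] by (intro homotopic_with_basepoint_intro[OF y0N c1]) (auto simp: h1_def G1 Gb r_y0)
  have 2: "homotopic_with (\<lambda>h. h (y0, y0) = y0) ?TN K (\<lambda>p. h1 (1, p)) (\<lambda>p. h2 (1, p))"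
  proof (rule homotopic_with_basepoint_intro[OF y0N c2])
    fix p assume "p \<in> topspace ?TN"
    then have p: "(fst p, snd p) \<in> N" using TN by simp
    \<comment> \<open>Up to radius 3/4 the chord starts at \<open>fst p\<close>; above it
      \<open>u\<close> is 1 and \<open>G\<close> at time 0 returns \<open>r (fst p)\<close>.\<close>
    show "h2 (0, p) = h1 (1, p)"
      using N_low[OF p] chord_ends(1)[of "fst p" "snd p"]
      by (auto simp: h1_def h2_def u_high G0)
  qed (use y0 in \<open>auto simp: h2_def r_y0\<close>)
  have 3: "homotopic_with (\<lambda>h. h (y0, y0) = y0) ?TN K (\<lambda>p. h2 (1, p)) (\<lambda>p. r (snd p))"
  proof (rule homotopic_with_basepoint_intro[OF y0N c3])
    fix p assume "p \<in> topspace ?TN"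
    then have p: "(fst p, snd p) \<in> N" using TN by simp
    show "h3 (0, p) = h2 (1, p)"
      using N_low[OF p] chord_ends(2)[of "fst p" "snd p"]
      by (auto simp: h3_def h2_def u_high G0)
    show "h3 (1, p) = r (snd p)" by (simp add: h3_def G1)
  next
    show "h3 (t, (y0, y0)) = y0" if "t \<in> {0..1}" for t
      using that y0 tu(2)[OF that u01, of y0] by (simp add: h3_def r_y0 Gb)
  qed
  from rfst 1 2 3 homotopic_with_symD[OF rsnd]
  have "homotopic_with (\<lambda>h. h (y0, y0) = y0) ?TN K fst snd" by (meson homotopic_with_trans)
  then show ?thesis using N N_diag unfolding diag_planner_def by blast
qed

end

section \<open>Finite subcomplexes\<close>

locale cw_structure =
  fixes Y :: "'b topology" and y0 :: 'b and C :: "'b set set" and dim :: "'b set \<Rightarrow> nat"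
    and \<Phi> :: "'b set \<Rightarrow> (nat \<Rightarrow> real) \<Rightarrow> 'b"
  assumes Hausdorff: "Hausdorff_space Y"
    and cells: "\<Union>C = topspace Y" "{} \<notin> C" "pairwise disjnt C"
    and cont_char: "\<And>e. e \<in> C \<Longrightarrow> continuous_map (disk (dim e)) Y (\<Phi> e)"
    and homeo_char: "\<And>e. e \<in> C \<Longrightarrow> homeomorphic_map (subtopology (powertop_real UNIV) (ball_set (dim e)))
                           (subtopology Y e) (\<Phi> e)"
    and char_boundary: "\<And>e. e \<in> C \<Longrightarrow> \<exists>D. finite D \<and> D \<subseteq> C \<and> (\<forall>d\<in>D. dim d < dim e) \<and>
               \<Phi> e ` (disk_set (dim e) - ball_set (dim e)) \<subseteq> \<Union>D"
    and coherent: "\<And>A. A \<subseteq> topspace Y \<Longrightarrow>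
          (\<And>e. e \<in> C \<Longrightarrow> closedin (disk (dim e)) (disk_set (dim e) \<inter> \<Phi> e -` A)) \<Longrightarrow> closedin Y A"
    and base_cell: "{y0} \<in> C" "dim {y0} = 0"
begin

text \<open>A finite set of cells rather than a subspace, so that induction can run on its
  cardinality. Covering each attaching sphere by members of lower dimension guarantees that a cell
  of top dimension can be removed.\<close>

definition subcomplex :: "'b set set \<Rightarrow> bool" where
  "subcomplex D \<longleftrightarrow> finite D \<and> D \<subseteq> C \<and> (\<forall>e\<in>D. \<exists>D'\<subseteq>D. (\<forall>d\<in>D'. dim d < dim e) \<and>
     \<Phi> e ` (disk_set (dim e) - ball_set (dim e)) \<subseteq> \<Union>D')"

lemma subcomplexE:
  assumes "subcomplex D" "e \<in> D"
  obtains D' where "D' \<subseteq> D" "\<forall>d\<in>D'. dim d < dim e" "\<Phi> e ` (disk_set (dim e) - ball_set (dim e)) \<subseteq> \<Union>D'"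
  using assms unfolding subcomplex_def by blast

lemma char_image_ball: "e \<in> C \<Longrightarrow> \<Phi> e ` ball_set (dim e) = e"
  using homeomorphic_imp_surjective_map[OF homeo_char] cells(1) by (auto simp: inf.absorb2)

lemma cells_eq: "d \<in> C \<Longrightarrow> e \<in> C \<Longrightarrow> y \<in> d \<Longrightarrow> y \<in> e \<Longrightarrow> d = e"
  using cells(3) by (auto simp: pairwise_def disjnt_iff)

lemma char_image_disk_subset:
  assumes "e \<in> C" "\<Phi> e ` (disk_set (dim e) - ball_set (dim e)) \<subseteq> \<Union>D"
  shows "\<Phi> e ` disk_set (dim e) \<subseteq> \<Union>(insert e D)"
  using assms char_image_ball[OF assms(1)] by blast

lemma subcomplex_Union:
  assumes "finite \<D>" "\<And>D. D \<in> \<D> \<Longrightarrow> subcomplex D"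
  shows "subcomplex (\<Union>\<D>)"
  unfolding subcomplex_def
proof (intro conjI ballI)
  show "finite (\<Union>\<D>)" "\<Union>\<D> \<subseteq> C" using assms by (auto simp: subcomplex_def)
  fix e assume "e \<in> \<Union>\<D>"
  then obtain D where D: "D \<in> \<D>" "e \<in> D" by blast
  obtain D' where "D' \<subseteq> D" "\<forall>d\<in>D'. dim d < dim e"
    "\<Phi> e ` (disk_set (dim e) - ball_set (dim e)) \<subseteq> \<Union>D'"
    using assms(2)[OF D(1)] D(2) by (rule subcomplexE)
  then show "\<exists>D'\<subseteq>\<Union>\<D>. (\<forall>d\<in>D'. dim d < dim e) \<and> \<Phi> e ` (disk_set (dim e) - ball_set (dim e)) \<subseteq> \<Union>D'"
    using D(1) by blast
qed

text \<open>Induction on dimension: the boundary of \<open>e\<close> is covered by finitely many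
  lower cells, each inside some subcomplex, and \<open>e\<close> is added to the union of
  these.\<close>

lemma cell_in_subcomplex: "e \<in> C \<Longrightarrow> \<exists>D. subcomplex D \<and> e \<in> D"
proof (induction "dim e" arbitrary: e rule: less_induct)
  case less
  obtain B where B: "finite B" "B \<subseteq> C" "\<forall>d\<in>B. dim d < dim e"
    "\<Phi> e ` (disk_set (dim e) - ball_set (dim e)) \<subseteq> \<Union>B"
    using char_boundary[OF less.prems] by blast
  have "\<forall>d\<in>B. \<exists>D. subcomplex D \<and> d \<in> D" using less.hyps B by blast
  then obtain F where F: "\<forall>d\<in>B. subcomplex (F d) \<and> d \<in> F d" by (rule bchoice[THEN exE])
  let ?U = "\<Union>(F ` B)"
  have U: "subcomplex ?U" using B(1) F by (intro subcomplex_Union) auto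
  have BU: "B \<subseteq> ?U" using F by blast
  have "subcomplex (insert e ?U)"
    unfolding subcomplex_def
  proof (intro conjI ballI)
    show "finite (insert e ?U)" "insert e ?U \<subseteq> C" using U less.prems by (auto simp: subcomplex_def)
    fix d assume "d \<in> insert e ?U"
    then consider "d = e" | "d \<in> ?U" by blast
    then show "\<exists>D'\<subseteq>insert e ?U. (\<forall>c\<in>D'. dim c < dim d) \<and> \<Phi> d ` (disk_set (dim d) - ball_set (dim d)) \<subseteq> \<Union>D'"
    proof cases
      case 1
      have "B \<subseteq> insert e ?U" using BU by (rule order.trans) (rule subset_insertI)
      then show ?thesis unfolding 1 using B(3,4) by (intro exI[of _ B] conjI)
    next
      case 2
      with U obtain D' where "D' \<subseteq> ?U" "\<forall>c\<in>D'. dim c < dim d" "\<Phi> d ` (disk_set (dim d) - ball_set (dim d)) \<subseteq> \<Union>D'"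
        by (rule subcomplexE)
      moreover from this(1) have "D' \<subseteq> insert e ?U" by (rule order.trans) (rule subset_insertI)
      ultimately show ?thesis by (intro exI[of _ D'] conjI)
    qed
  qed
  then show ?case by blast
qed

text \<open>A subcomplex contains the boundaries of its cells, so the union of its cells is also the
  finite union of the compact images of the closed disks.\<close>

lemma subcomplex_compact:
  assumes "subcomplex D"
  shows "compactin Y (\<Union>D)"
proof -
  have D: "finite D" "D \<subseteq> C" using assms by (auto simp: subcomplex_def)
  have "\<Union>D = \<Union>((\<lambda>e. \<Phi> e ` disk_set (dim e)) ` D)"
  proof
    show "\<Union>D \<subseteq> \<Union>((\<lambda>e. \<Phi> e ` disk_set (dim e)) ` D)"
    proof
      fix y assume "y \<in> \<Union>D"
      then obtain e where e: "e \<in> D" "y \<in> e" by blast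
      then have "y \<in> \<Phi> e ` ball_set (dim e)" using char_image_ball D by blast
      moreover have "ball_set (dim e) \<subseteq> disk_set (dim e)" by (auto simp: ball_set_def disk_set_def)
      ultimately show "y \<in> \<Union>((\<lambda>e. \<Phi> e ` disk_set (dim e)) ` D)" using e by blast
    qed
    show "\<Union>((\<lambda>e. \<Phi> e ` disk_set (dim e)) ` D) \<subseteq> \<Union>D"
    proof (rule Union_least)
      fix Z assume "Z \<in> (\<lambda>e. \<Phi> e ` disk_set (dim e)) ` D"
      then obtain e where e: "e \<in> D" and Z: "Z = \<Phi> e ` disk_set (dim e)" by blast
      obtain D' where "D' \<subseteq> D" "\<Phi> e ` (disk_set (dim e) - ball_set (dim e)) \<subseteq> \<Union>D'"
        using assms e by (rule subcomplexE)
      then show "Z \<subseteq> \<Union>D" using char_image_disk_subset[of e D'] e D Z by blast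
    qed
  qed
  moreover have "compactin Y (\<Union>((\<lambda>e. \<Phi> e ` disk_set (dim e)) ` D))"
  proof (rule compactin_Union)
    fix Z assume "Z \<in> (\<lambda>e. \<Phi> e ` disk_set (dim e)) ` D"
    then obtain e where e: "e \<in> D" and Z: "Z = \<Phi> e ` disk_set (dim e)" by blast
    have "compactin (disk (dim e)) (disk_set (dim e))"
      using compact_space_disk[of "dim e"] by (simp add: compact_space_def)
    then show "compactin Y Z" unfolding Z using e D by (intro image_compactin[OF _ cont_char]) auto
  qed (use D in simp)
  ultimately show ?thesis by simp
qed

text \<open>Choose one point of \<open>Q\<close> in each cell that it meets. By coherence every set
  of chosen points is closed, since a closed cell contains only finitely many of them. So they form
  a compact set without accumulation points among them, which is finite.\<close>

lemma compact_meets_finitely_many_cells: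
  assumes Q: "compactin Y Q"
  shows "finite {e \<in> C. e \<inter> Q \<noteq> {}}" (is "finite ?T")
proof -
  have "\<forall>e\<in>?T. \<exists>y. y \<in> e \<inter> Q" by blast
  then obtain p where p: "\<forall>e\<in>?T. p e \<in> e \<inter> Q" by (rule bchoice[THEN exE])
  have inj: "inj_on p ?T" using p cells_eq unfolding inj_on_def by (metis (no_types, lifting) IntD1 mem_Collect_eq)
  define P where "P = p ` ?T"
  have PQ: "P \<subseteq> Q" using p unfolding P_def by blast
  have QY: "Q \<subseteq> topspace Y" using Q by (rule compactin_subset_topspace)
  have closed: "closedin Y S" if S: "S \<subseteq> P" for S
  proof (rule coherent)
    show SY: "S \<subseteq> topspace Y" using S PQ QY by blast
    fix e assume e: "e \<in> C"
    then obtain B where B: "finite B" "B \<subseteq> C" "\<Phi> e ` (disk_set (dim e) - ball_set (dim e)) \<subseteq> \<Union>B"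
      using char_boundary by meson
    have sub: "\<Phi> e ` disk_set (dim e) \<subseteq> \<Union>(insert e B)" using e B(3) by (rule char_image_disk_subset)
    let ?S = "S \<inter> \<Union>(insert e B)"
    \<comment> \<open>The closed cell is covered by \<open>e\<close> and the finitely many cells in
      \<open>B\<close>, and cells are disjoint, so each of these contributes at most its own chosen
      point.\<close>
    have "?S \<subseteq> p ` insert e B"
    proof
      fix y assume y: "y \<in> ?S"
      then obtain d where d: "d \<in> ?T" "y = p d" using S unfolding P_def by blast
      then have "y \<in> d" "d \<in> C" using p by auto
      moreover obtain d' where "d' \<in> insert e B" "y \<in> d'" using y by blast
      moreover from this have "d' \<in> C" using e B by blast
      ultimately have "d = d'" using cells_eq by blast
      then show "y \<in> p ` insert e B" using d \<open>d' \<in> insert e B\<close> by blast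
    qed
    then have "finite ?S" by (rule finite_subset) (use B in simp)
    then have "closedin Y ?S"
      using SY Hausdorff by (intro closedin_Hausdorff_finite) auto
    then have "closedin (disk (dim e)) {w \<in> topspace (disk (dim e)). \<Phi> e w \<in> ?S}"
      using cont_char[OF e] by (intro closedin_continuous_map_preimage)
    moreover have "{w \<in> topspace (disk (dim e)). \<Phi> e w \<in> ?S} = disk_set (dim e) \<inter> \<Phi> e -` S"
      using sub by auto
    ultimately show "closedin (disk (dim e)) (disk_set (dim e) \<inter> \<Phi> e -` S)" by simp
  qed
  have "compactin Y (P)" using Q PQ closed[OF subset_refl] by (rule closed_compactin)
  moreover have "P \<inter> Y derived_set_of (P) = {}"
  proof -
    have "y \<notin> Y derived_set_of (P)" if "y \<in> P" for y
    proof
      assume d: "y \<in> Y derived_set_of (P)"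
      have "openin Y (topspace Y - (P - {y}))" using closed[of "P - {y}"] by blast
      moreover have "y \<in> topspace Y - (P - {y})" using that PQ QY by blast
      ultimately obtain z where "z \<noteq> y" "z \<in> P" "z \<in> topspace Y - (P - {y})"
        using d unfolding in_derived_set_of by meson
      then show False by blast
    qed
    then show ?thesis by blast
  qed
  ultimately have "finite (P)" using discrete_compactin_eq_finite by blast
  then show ?thesis using inj by (simp add: P_def finite_image_iff)
qed

lemma compact_in_subcomplex:
  assumes Q: "compactin Y Q"
  obtains D where "subcomplex D" "Q \<subseteq> \<Union>D" "{y0} \<in> D"
proof -
  let ?T = "insert {y0} {e \<in> C. e \<inter> Q \<noteq> {}}"
  have fin: "finite ?T" using compact_meets_finitely_many_cells[OF Q] by simp
  have "\<forall>e\<in>?T. \<exists>D. subcomplex D \<and> e \<in> D" using cell_in_subcomplex base_cell by blast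
  then obtain F where F: "\<forall>e\<in>?T. subcomplex (F e) \<and> e \<in> F e" by (rule bchoice[THEN exE])
  show thesis
  proof
    show "subcomplex (\<Union>(F ` ?T))" using fin F by (intro subcomplex_Union) auto
    show "{y0} \<in> \<Union>(F ` ?T)" using F by blast
    show "Q \<subseteq> \<Union>(\<Union>(F ` ?T))"
    proof
      fix y assume y: "y \<in> Q"
      then obtain e where "e \<in> C" "y \<in> e" using compactin_subset_topspace[OF Q] cells(1) by blast
      then have "e \<in> ?T" using y by blast
      then show "y \<in> \<Union>(\<Union>(F ` ?T))" using F \<open>y \<in> e\<close> by blast
    qed
  qed
qed

text \<open>On a one-point space the two projections coincide, so the constant homotopy
  serves.\<close>

lemma diag_planner_point: "diag_planner (subtopology Y {y0}) y0"
proof -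
  let ?K = "subtopology Y {y0}"
  have y0: "y0 \<in> topspace Y" using cells(1) base_cell by blast
  then have top: "topspace ?K = {y0}" by auto
  let ?N = "topspace (prod_topology ?K ?K)"
  have "homotopic_with (\<lambda>h. h (y0, y0) = y0) (subtopology (prod_topology ?K ?K) ?N) ?K fst snd"
    by (rule homotopic_with_equal)
       (auto simp: top intro: continuous_map_from_subtopology continuous_map_fst)
  then show ?thesis unfolding diag_planner_def
    by (intro exI[of _ ?N] conjI openin_topspace) auto
qed

text \<open>Induction on the number of cells, removing one of largest dimension. The cell
  \<open>{y0}\<close> must stay because the planner fixes the basepoint, so the maximum is taken
  over the other cells.\<close>

lemma diag_planner_subcomplex:
  assumes "subcomplex D" "{y0} \<in> D"
  shows "diag_planner (subtopology Y (\<Union>D)) y0"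
  using assms
proof (induction "card D" arbitrary: D rule: less_induct)
  case less
  have D: "finite D" "D \<subseteq> C" using less.prems by (auto simp: subcomplex_def)
  show ?case
  proof (cases "D = {{y0}}")
    case True
    then show ?thesis using diag_planner_point by simp
  next
    case False
    then have ne: "D - {{y0}} \<noteq> {}" using less.prems by blast
    obtain e where e: "e \<in> D" "e \<noteq> {y0}" and max: "\<And>d. d \<in> D \<Longrightarrow> d \<noteq> {y0} \<Longrightarrow> dim d \<le> dim e"
    proof -
      have "finite (dim ` (D - {{y0}}))" "dim ` (D - {{y0}}) \<noteq> {}" using D ne by auto
      from Max_in[OF this] obtain e where "e \<in> D - {{y0}}" "Max (dim ` (D - {{y0}})) = dim e" by auto
      with Max_ge[OF \<open>finite (dim ` (D - {{y0}}))\<close>] show thesis by (intro that[of e]) auto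
    qed
    let ?D = "D - {e}"
    \<comment> \<open>As \<open>{y0}\<close> has dimension 0, \<open>e\<close> is of maximal
      dimension in all of \<open>D\<close>. It is therefore never among the lower cells that carry a
      boundary, and removing it leaves a subcomplex.\<close>
    have notin: "D' \<subseteq> ?D" if "d \<in> D" "D' \<subseteq> D" "\<forall>c\<in>D'. dim c < dim d" for d D'
    proof -
      have "dim d \<le> dim e" using max[of d] that(1) base_cell(2) by (cases "d = {y0}") auto
      then show ?thesis using that by fastforce
    qed
    have sub: "subcomplex ?D"
      unfolding subcomplex_def
    proof (intro conjI ballI)
      show "finite ?D" "?D \<subseteq> C" using D by auto
      fix d assume d: "d \<in> ?D"
      then have dD: "d \<in> D" by blast
      with less.prems(1) obtain D' where D': "D' \<subseteq> D" "\<forall>c\<in>D'. dim c < dim d"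
        "\<Phi> d ` (disk_set (dim d) - ball_set (dim d)) \<subseteq> \<Union>D'"
        by (rule subcomplexE)
      then show "\<exists>D'\<subseteq>?D. (\<forall>c\<in>D'. dim c < dim d) \<and> \<Phi> d ` (disk_set (dim d) - ball_set (dim d)) \<subseteq> \<Union>D'"
        using notin[OF dD D'(1,2)] by (intro exI[of _ D'] conjI)
    qed
    have base: "{y0} \<in> ?D" using less.prems e by blast
    have "card ?D < card D" using D e by (intro psubset_card_mono) auto
    then have IH: "diag_planner (subtopology Y (\<Union>?D)) y0" using sub base by (rule less.hyps)
    let ?K = "subtopology Y (\<Union>D)"
    have KY: "\<Union>D \<subseteq> topspace Y" using D cells by blast
    have top: "topspace ?K = \<Union>D" using KY by auto
    have eC: "e \<in> C" using e D by blast
    have diff: "topspace ?K - \<Union>?D = e"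
    proof -
      have "y \<notin> d" if "y \<in> e" "d \<in> ?D" for y d using that cells_eq[of d e y] D eC by blast
      then show ?thesis unfolding top using e by blast
    qed
    obtain D' where "D' \<subseteq> D" "\<forall>c\<in>D'. dim c < dim e" and D'2: "\<Phi> e ` (disk_set (dim e) - ball_set (dim e)) \<subseteq> \<Union>D'"
      using less.prems(1) e(1) by (rule subcomplexE)
    note D' = notin[OF e(1) this(1,2)] D'2
    interpret cell_attachment ?K "\<Union>?D" "dim e" "\<Phi> e"
    proof
      show "Hausdorff_space ?K" using Hausdorff by (rule Hausdorff_space_subtopology)
      have "closedin Y (\<Union>?D)"
        using Hausdorff subcomplex_compact[OF sub] by (rule compactin_imp_closedin)
      then show "closedin ?K (\<Union>?D)" by (rule closedin_subset_topspace) blast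
      have "\<Phi> e ` disk_set (dim e) \<subseteq> \<Union>D"
        using char_image_disk_subset[OF eC D'(2)] D'(1) e by blast
      then show "continuous_map (disk (dim e)) ?K (\<Phi> e)"
        using cont_char[OF eC] by (auto simp: continuous_map_in_subtopology)
      have "\<Union>D \<inter> e = e" using e by blast
      then show "homeomorphic_map (subtopology (powertop_real UNIV) (ball_set (dim e)))
          (subtopology ?K (topspace ?K - \<Union>?D)) (\<Phi> e)"
        using homeo_char[OF eC] unfolding diff by (simp add: subtopology_subtopology)
      show "\<Phi> e ` (disk_set (dim e) - ball_set (dim e)) \<subseteq> \<Union>?D" using D' by blast
    qed
    have "\<Union>D \<inter> \<Union>?D = \<Union>?D" by blast
    then have "diag_planner (subtopology ?K (\<Union>?D)) y0" using IH by (simp add: subtopology_subtopology)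
    then show ?thesis using base by (intro diag_planner_attach) auto
  qed
qed

end

text \<open>Apart from the Hausdorff property, this is all that the later arguments take from the
  cell structure of \<open>Y\<close>.\<close>

lemma cellular_compact_diag_planner:
  assumes "cellular Y y0" "compactin Y Q"
  obtains K where "compactin Y K" "Q \<subseteq> K" "y0 \<in> K" "diag_planner (subtopology Y K) y0"
proof -
  have "\<exists>C dim \<Phi>. cw_structure Y y0 C dim \<Phi>"
    using assms(1) unfolding cellular_def
    apply (elim conjE exE)
    subgoal for C dim \<Phi>
      by (rule exI[of _ C], rule exI[of _ dim], rule exI[of _ \<Phi>], rule cw_structure.intro) simp_all
    done
  then obtain C dim \<Phi> where "cw_structure Y y0 C dim \<Phi>" by blast
  then interpret cw_structure Y y0 C dim \<Phi> .
  obtain D where "subcomplex D" "Q \<subseteq> \<Union>D" "{y0} \<in> D"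
    using assms(2) by (rule compact_in_subcomplex)
  then show thesis
    using subcomplex_compact diag_planner_subcomplex by (intro that[of "\<Union>D"]) auto
qed

section \<open>Homotopy invariance of strong similarity\<close>

lemma topspace_std_simplex [simp]: "topspace (std_simplex E) = simplex_set E"
  by (simp add: std_simplex_def)

lemma compact_space_std_simplex:
  assumes "finite E"
  shows "compact_space (std_simplex E)"
proof -
  let ?P = "powertop_real (UNIV::nat set)"
  have "compactin ?P (PiE UNIV (\<lambda>_. {0..1}))" by (simp add: compactin_PiE)
  moreover have "simplex_set E \<subseteq> PiE UNIV (\<lambda>_. {0..1})"
  proof
    fix t assume t: "t \<in> simplex_set E"
    have "t i \<le> 1" for i
    proof (cases "i \<in> E")
      case True
      then have "t i \<le> (\<Sum>i\<in>E. t i)" using t assms by (intro member_le_sum) (auto simp: simplex_set_def)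
      then show ?thesis using t by (simp add: simplex_set_def)
    qed (use t in \<open>simp add: simplex_set_def\<close>)
    then show "t \<in> PiE UNIV (\<lambda>_. {0..1})" using t by (auto simp: simplex_set_def)
  qed
  moreover have "closedin ?P (simplex_set E)"
  proof -
    have "closed {t::nat \<Rightarrow> real. \<forall>i. 0 \<le> t i}"
      by (intro closed_Collect_all closed_Collect_le continuous_intros continuous_on_product_coordinates)
    moreover have "closed {t::nat \<Rightarrow> real. \<forall>i. i \<notin> E \<longrightarrow> t i = 0}"
      by (intro closed_Collect_all closed_Collect_imp closed_Collect_eq continuous_intros
          continuous_on_product_coordinates) auto
    moreover have "closed {t::nat \<Rightarrow> real. (\<Sum>i\<in>E. t i) = 1}"
      by (intro closed_Collect_eq continuous_intros continuous_on_product_coordinates)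
    ultimately have "closed (simplex_set E)" unfolding simplex_set_def by (intro closed_Collect_conj)
    then show ?thesis by (simp add: euclidean_product_topology)
  qed
  ultimately have "compactin ?P (simplex_set E)" by (rule closed_compactin)
  then show ?thesis by (simp add: std_simplex_def compact_space_subtopology)
qed

lemma cellular_imp_Hausdorff: "cellular X x0 \<Longrightarrow> Hausdorff_space X"
  by (simp add: cellular_def)

lemma cellular_imp_basepoint: "cellular X x0 \<Longrightarrow> x0 \<in> topspace X"
  unfolding cellular_def by (elim conjE exE) (metis UnionI singletonI)

text \<open>The set \<open>M\<close> serves to keep all maps inside one finite subcomplex while \<open>b\<close> is deformed.\<close>

definition ssim_at :: "'a topology \<Rightarrow> 'a \<Rightarrow> 'b topology \<Rightarrow> 'b \<Rightarrow> nat \<Rightarrow> nat set \<Rightarrow> ('a \<Rightarrow> 'b) set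
    \<Rightarrow> ('a \<Rightarrow> 'b) \<Rightarrow> ('a \<Rightarrow> 'b) \<Rightarrow> bool" where
  "ssim_at X x0 Y y0 r E M a b \<longleftrightarrow>
     (\<exists>S. S \<in> fab (umaps (std_simplex E)
                 (subtopology (mapspace X x0 Y y0) (path_component_of_set (mapspace X x0 Y y0) a))) \<and>
          fissile E S \<and>
          wr_filt X x0 (std_simplex E) (r + 1) (\<lambda>w. gen (const_map (std_simplex E) b) w - S w) \<and>
          (\<forall>w u. S w \<noteq> 0 \<longrightarrow> u \<in> simplex_set E \<longrightarrow> w u \<in> M))"

text \<open>With \<open>M\<close> the set of all based maps the extra clause is automatic, since the
  maps in the support of \<open>S\<close> take values in a path component of the mapping
  space.\<close>

lemma ssim_iff_ssim_at:
  assumes "compact_space X" "Hausdorff_space X" "x0 \<in> topspace X" "a \<in> based_maps X x0 Y y0"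
  shows "ssim X x0 Y y0 r a b \<longleftrightarrow>
    (\<forall>E. finite E \<and> E \<noteq> {} \<longrightarrow> ssim_at X x0 Y y0 r E (based_maps X x0 Y y0) a b)"
proof -
  have vals: "w u \<in> based_maps X x0 Y y0"
    if "S \<in> fab (umaps (std_simplex E)
                 (subtopology (mapspace X x0 Y y0) (path_component_of_set (mapspace X x0 Y y0) a)))"
      "S w \<noteq> 0" "u \<in> simplex_set E" for S E w u
    using that umaps_path_component_mapspace[OF assms, of w "std_simplex E"] by (auto simp: fab_def)
  show ?thesis unfolding ssim_def ssim_at_def
  proof (intro iff_allI imp_cong refl iff_exI conj_cong)
    fix E and S :: "((nat \<Rightarrow> real) \<Rightarrow> 'a \<Rightarrow> 'b) \<Rightarrow> int"
    assume "S \<in> fab (umaps (std_simplex E)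
                 (subtopology (mapspace X x0 Y y0) (path_component_of_set (mapspace X x0 Y y0) a)))"
    from vals[OF this] have "\<forall>w u. S w \<noteq> 0 \<longrightarrow> u \<in> simplex_set E \<longrightarrow> w u \<in> based_maps X x0 Y y0"
      by blast
    then show "wr_filt X x0 (std_simplex E) (r + 1) (\<lambda>w. gen (const_map (std_simplex E) b) w - S w) \<longleftrightarrow>
        wr_filt X x0 (std_simplex E) (r + 1) (\<lambda>w. gen (const_map (std_simplex E) b) w - S w) \<and>
        (\<forall>w u. S w \<noteq> 0 \<longrightarrow> u \<in> simplex_set E \<longrightarrow> w u \<in> based_maps X x0 Y y0)"
      by simp
  qed
qed

text \<open>The common transport principle: apply \<open>P\<close> to every value of every map in
  \<open>S\<close>. Locality, with \<open>\<xi> x\<close> the only point at which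
  \<open>P f x\<close> reads \<open>f\<close>, protects the filtration; \<open>hom\<close> controls
  the path component and \<open>cont\<close> continuity. It is used with the identity, with a
  deformation that moves \<open>b\<close> to a nearby map, and with left translation.\<close>

lemma ssim_at_push:
  assumes X: "compact_space X" "Hausdorff_space X" and x0: "x0 \<in> topspace X"
    and E: "finite E" and a: "a \<in> based_maps X x0 Y y0" "a' \<in> based_maps X x0 Y y0"
    and ss: "ssim_at X x0 Y y0 r E M a b" and b: "b \<in> M" and M: "M \<subseteq> based_maps X x0 Y y0"
    and PM: "\<And>f. f \<in> M \<Longrightarrow> P f \<in> M'" and M': "M' \<subseteq> based_maps X x0 Y y0"
    and \<xi>: "\<And>x. x \<in> topspace X \<Longrightarrow> \<xi> x \<in> topspace X"
    and loc: "\<And>f g x. f \<in> M \<Longrightarrow> g \<in> M \<Longrightarrow> x \<in> topspace X \<Longrightarrow> f (\<xi> x) = g (\<xi> x) \<Longrightarrow> P f x = P g x"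
    and hom: "\<And>f. f \<in> M \<Longrightarrow> homotopic_with (\<lambda>h. h x0 = y0) X Y a f
                \<Longrightarrow> homotopic_with (\<lambda>h. h x0 = y0) X Y a' (P f)"
    and cont: "\<And>w. continuous_map (prod_topology (std_simplex E) X) Y (\<lambda>(u, x). w u x) \<Longrightarrow>
                (\<And>u. u \<in> simplex_set E \<Longrightarrow> w u \<in> M) \<Longrightarrow>
                continuous_map (prod_topology (std_simplex E) X) Y (\<lambda>(u, x). P (w u) x)"
  shows "ssim_at X x0 Y y0 r E M' a' (P b)"
proof -
  let ?U = "std_simplex E"
  let ?W = "\<lambda>a. umaps ?U (subtopology (mapspace X x0 Y y0) (path_component_of_set (mapspace X x0 Y y0) a))"
  obtain S where S: "S \<in> fab (?W a)" "fissile E S"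
    and filt: "wr_filt X x0 ?U (r + 1) (\<lambda>w. gen (const_map ?U b) w - S w)"
    and SM: "\<And>w u. S w \<noteq> 0 \<Longrightarrow> u \<in> simplex_set E \<Longrightarrow> w u \<in> M"
    using ss unfolding ssim_at_def by blast
  have finS: "finite {w. S w \<noteq> 0}" and SW: "\<And>w. S w \<noteq> 0 \<Longrightarrow> w \<in> ?W a" using S(1) by (auto simp: fab_def)
  let ?Q = "\<lambda>w. restrict (\<lambda>u. P (w u)) (simplex_set E)"
  let ?S' = "pushfwd ?Q S"
  have QW: "?Q w \<in> ?W a'" if w: "S w \<noteq> 0" for w
  proof -
    have wc: "continuous_map (prod_topology ?U X) Y (\<lambda>(u, x). w u x)"
      and wh: "\<And>u. u \<in> simplex_set E \<Longrightarrow> homotopic_with (\<lambda>h. h x0 = y0) X Y a (w u)"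
      using SW[OF w] umaps_path_component_mapspace[OF X x0 a(1), of w ?U] by auto
    have "continuous_map (prod_topology ?U X) Y (\<lambda>(u, x). P (w u) x)"
      using wc SM[OF w] by (rule cont)
    then have "continuous_map (prod_topology ?U X) Y (\<lambda>(u, x). ?Q w u x)"
      by (rule continuous_map_eq) auto
    moreover have "?Q w u \<in> based_maps X x0 Y y0 \<and> homotopic_with (\<lambda>h. h x0 = y0) X Y a' (?Q w u)"
      if "u \<in> topspace ?U" for u
    proof -
      have u: "u \<in> simplex_set E" using that by simp
      then show ?thesis using hom[OF SM[OF w u] wh[OF u]] PM[OF SM[OF w u]] M' by auto
    qed
    moreover have "?Q w \<in> extensional (topspace ?U)" by simp
    ultimately show ?thesis
      unfolding umaps_path_component_mapspace[OF X x0 a(2)] by blast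
  qed
  have supp: "\<exists>w. S w \<noteq> 0 \<and> v = ?Q w" if "?S' v \<noteq> 0" for v
    using support_pushfwd[of ?Q S] that by blast
  have S'fab: "?S' \<in> fab (?W a')"
    unfolding fab_def using finite_support_pushfwd[OF finS] supp QW by blast
  have S'fis: "fissile E ?S'" using E finS S(2) by (rule fissile_pushfwd)
  have gen_fin: "finite {w. gen v w \<noteq> 0}" for v :: "(nat \<Rightarrow> real) \<Rightarrow> 'a \<Rightarrow> 'b"
    by (rule finite_subset[of _ "{v}"]) (auto simp: gen_def)
  let ?V = "\<lambda>w. gen (const_map ?U b) w - S w"
  have V_supp: "w = const_map ?U b \<or> S w \<noteq> 0" if "?V w \<noteq> 0" for w
    using that by (auto simp: gen_def split: if_splits)
  have V_fin: "finite {w. ?V w \<noteq> 0}"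
    by (rule finite_subset[of _ "insert (const_map ?U b) {w. S w \<noteq> 0}"]) (use V_supp finS in auto)
  have "wr_filt X x0 ?U (r + 1) (pushfwd (\<lambda>w. restrict (\<lambda>u. P (w u)) (topspace ?U)) ?V)"
  proof (rule wr_filt_pushfwd[OF V_fin filt, where \<xi> = \<xi> and M = M and ?y0.0 = y0])
    fix w u assume w: "?V w \<noteq> 0" and "u \<in> topspace ?U"
    then have u: "u \<in> simplex_set E" by simp
    \<comment> \<open>The constant family at \<open>b\<close> occurs in the difference too, so
      locality must cover it; hence the assumption \<open>b \<in> M\<close>.\<close>
    from V_supp[OF w] show "w u \<in> M" using u b SM by (auto simp: const_map_def)
  next
    fix f assume "f \<in> M"
    then show "f x0 = y0" using M by (auto simp: based_maps_def)
  qed (fact \<xi> loc)+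
  moreover have "pushfwd (\<lambda>w. restrict (\<lambda>u. P (w u)) (topspace ?U)) ?V
      = (\<lambda>w. gen (const_map ?U (P b)) w - ?S' w)"
  proof
    fix v
    have "?Q (const_map ?U b) = const_map ?U (P b)" by (auto simp: const_map_def restrict_def fun_eq_iff)
    then show "pushfwd (\<lambda>w. restrict (\<lambda>u. P (w u)) (topspace ?U)) ?V v
        = gen (const_map ?U (P b)) v - ?S' v"
      using pushfwd_diff[OF gen_fin finS, of ?Q "const_map ?U b" v] by (simp add: pushfwd_gen)
  qed
  ultimately have "wr_filt X x0 ?U (r + 1) (\<lambda>w. gen (const_map ?U (P b)) w - ?S' w)" by simp
  moreover have "w u \<in> M'" if "?S' w \<noteq> 0" "u \<in> simplex_set E" for w u
    using supp[OF that(1)] that(2) SM PM by auto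
  ultimately show ?thesis unfolding ssim_at_def using S'fab S'fis by blast
qed

text \<open>\<open>P\<close> is the identity: \<open>S\<close> is kept and only the reference point
  of its path component changes.\<close>

lemma ssim_homotopic_left:
  assumes X: "compact_space X" "Hausdorff_space X" and x0: "x0 \<in> topspace X"
    and a: "a \<in> based_maps X x0 Y y0" "a' \<in> based_maps X x0 Y y0" and b: "b \<in> based_maps X x0 Y y0"
    and hom: "homotopic_with (\<lambda>h. h x0 = y0) X Y a' a" and ss: "ssim X x0 Y y0 r a b"
  shows "ssim X x0 Y y0 r a' b"
  unfolding ssim_iff_ssim_at[OF X x0 a(2)]
proof (intro allI impI)
  fix E :: "nat set" assume E: "finite E \<and> E \<noteq> {}"
  then have 1: "ssim_at X x0 Y y0 r E (based_maps X x0 Y y0) a b"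
    using ss ssim_iff_ssim_at[OF X x0 a(1)] by blast
  show "ssim_at X x0 Y y0 r E (based_maps X x0 Y y0) a' b"
    using E hom by (intro ssim_at_push[OF X x0 _ a 1 b, where P = "\<lambda>f. f" and \<xi> = "\<lambda>x. x"])
      (auto intro: homotopic_with_trans)
qed

lemma graph_transport:
  assumes X: "compact_space X" "Hausdorff_space X" and K: "compact_space K" "Hausdorff_space K"
    and N: "openin (prod_topology K K) N"
    and hom: "homotopic_with (\<lambda>h. h (y0, y0) = y0) (subtopology (prod_topology K K) N) K fst snd"
    and b: "continuous_map X K b" "continuous_map X K b'" and x0: "x0 \<in> topspace X" "b' x0 = y0"
    and bN: "\<And>x. x \<in> topspace X \<Longrightarrow> (b x, b' x) \<in> N"
  obtains H where "continuous_map (prod_topology (top_of_set {0..1::real}) (prod_topology X K)) K H"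
    "\<And>p. H (0, p) = snd p" "\<And>x. x \<in> topspace X \<Longrightarrow> H (1, (x, b x)) = b' x"
    "\<And>t. t \<in> {0..1} \<Longrightarrow> H (t, (x0, y0)) = y0"
proof -
  let ?I = "top_of_set {0..1::real}"
  let ?KK = "prod_topology K K"
  let ?XK = "prod_topology X K"
  obtain G where G: "continuous_map (prod_topology ?I (subtopology ?KK N)) K G"
    and G0: "\<And>p. G (0, p) = fst p" and G1: "\<And>p. G (1, p) = snd p"
    and Gb: "\<And>t. t \<in> {0..1} \<Longrightarrow> G (t, (y0, y0)) = y0"
    using hom unfolding homotopic_with_def by auto
  define U where "U = {p \<in> topspace ?XK. (snd p, b' (fst p)) \<in> N}"
  define \<Gamma> where "\<Gamma> = {p \<in> topspace ?XK. b (fst p) = snd p}"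
  have cb: "continuous_map ?XK K (\<lambda>p. b (fst p))" and cb': "continuous_map ?XK K (\<lambda>p. b' (fst p))"
    using continuous_map_compose[OF continuous_map_fst] b by (auto simp: o_def)
  have "continuous_map ?XK ?KK (\<lambda>p. (snd p, b' (fst p)))"
    using cb' continuous_map_snd by (simp add: continuous_map_pairwise o_def)
  then have U: "openin ?XK U" unfolding U_def using N by (rule openin_continuous_map_preimage)
  have \<Gamma>: "closedin ?XK \<Gamma>"
    unfolding \<Gamma>_def using K(2) cb continuous_map_snd by (rule closedin_continuous_maps_eq)
  have normal: "normal_space ?XK"
    using X K by (intro compact_Hausdorff_or_regular_imp_normal_space)
      (auto simp: compact_space_prod_topology Hausdorff_space_prod_topology)
  have disj: "disjnt (topspace ?XK - U) \<Gamma>"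
    using bN by (auto simp: disjnt_iff U_def \<Gamma>_def)
  have "closedin ?XK (topspace ?XK - U)" using U by blast
  then obtain l where l: "continuous_map ?XK (top_of_set {0..1::real}) l"
    and l0: "l ` (topspace ?XK - U) \<subseteq> {0}" and l1: "l ` \<Gamma> \<subseteq> {1}"
    using Urysohn_lemma[OF normal _ \<Gamma> disj, of 0 1] by auto
  have l01: "l p \<in> {0..1}" if "p \<in> topspace ?XK" for p
    using l that by (auto simp: continuous_map_in_subtopology)
  have lr: "continuous_map ?XK euclideanreal l" using l by (simp add: continuous_map_in_subtopology)
  let ?T = "prod_topology ?I ?XK"
  \<comment> \<open>Cutting at \<open>l = 1/2\<close> confines \<open>G\<close> to a closed set
    inside \<open>U\<close>. The factor \<open>2 * l (snd q) - 1\<close> vanishes at the cut, where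
    \<open>G\<close> returns its first argument and the branches agree, and is 1 on the graph, so
    time 1 reaches \<open>b' x\<close>.\<close>
  define H where "H = (\<lambda>q. if l (snd q) \<le> 1/2 then snd (snd q)
      else G (fst q * (2 * l (snd q) - 1), (snd (snd q), b' (fst (snd q)))))"
  have lq: "continuous_map ?T euclideanreal (\<lambda>q. l (snd q))"
    using continuous_map_compose[OF continuous_map_snd lr] by (simp add: o_def)
  have cy: "continuous_map ?T K (\<lambda>q. snd (snd q))"
    using continuous_map_compose[OF continuous_map_snd continuous_map_snd] by (simp add: o_def)
  have cb'': "continuous_map ?T K (\<lambda>q. b' (fst (snd q)))"
    using continuous_map_compose[OF continuous_map_snd cb'] by (simp add: o_def)
  have ct: "continuous_map ?T euclideanreal fst"
    using continuous_map_fst[of ?I ?XK] by (simp add: continuous_map_in_subtopology)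
  have "continuous_map ?T K H"
    unfolding H_def
  proof (rule continuous_map_cases_le[OF lq])
    show "continuous_map (subtopology ?T {q. q \<in> topspace ?T \<and> l (snd q) \<le> 1/2}) K (\<lambda>q. snd (snd q))"
      using cy by (rule continuous_map_from_subtopology)
    let ?S = "subtopology ?T {q. q \<in> topspace ?T \<and> 1/2 \<le> l (snd q)}"
    have in_N: "(snd (snd q), b' (fst (snd q))) \<in> N" if "q \<in> topspace ?S" for q
    proof -
      have q: "snd q \<in> topspace ?XK" "l (snd q) \<noteq> 0" using that by auto
      then have "snd q \<in> U" using l0 by blast
      then show ?thesis by (simp add: U_def)
    qed
    have time: "fst q * (2 * l (snd q) - 1) \<in> {0..1}" if "q \<in> topspace ?S" for q
    proof -
      have "0 \<le> fst q" "fst q \<le> 1" "0 \<le> 2 * l (snd q) - 1" "2 * l (snd q) - 1 \<le> 1"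
        using that l01[of "snd q"] by auto
      then show ?thesis by (simp add: mult_le_one)
    qed
    have "continuous_map ?S euclideanreal (\<lambda>q. fst q * (2 * l (snd q) - 1))"
      by (intro continuous_intros continuous_map_from_subtopology ct lq)
    then have "continuous_map ?S ?I (\<lambda>q. fst q * (2 * l (snd q) - 1))"
      unfolding continuous_map_in_subtopology using time by blast
    moreover have "continuous_map ?S ?KK (\<lambda>q. (snd (snd q), b' (fst (snd q))))"
      using cy cb'' by (simp add: continuous_map_pairwise o_def continuous_map_from_subtopology)
    then have "continuous_map ?S (subtopology ?KK N) (\<lambda>q. (snd (snd q), b' (fst (snd q))))"
      unfolding continuous_map_in_subtopology using in_N by blast
    ultimately have "continuous_map ?S (prod_topology ?I (subtopology ?KK N))
        (\<lambda>q. (fst q * (2 * l (snd q) - 1), (snd (snd q), b' (fst (snd q)))))"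
      unfolding continuous_map_pairwise by (simp add: o_def)
    from continuous_map_compose[OF this G]
    show "continuous_map ?S K (\<lambda>q. G (fst q * (2 * l (snd q) - 1), (snd (snd q), b' (fst (snd q)))))"
      by (simp add: o_def)
    fix q :: "real \<times> 'a \<times> 'b" assume "l (snd q) = 1/2"
    then have "2 * l (snd q) - 1 = 0" by simp
    then show "snd (snd q) = G (fst q * (2 * l (snd q) - 1), (snd (snd q), b' (fst (snd q))))"
      by (simp only: mult_zero_right G0 fst_conv)
  qed simp
  moreover have "H (1, (x, b x)) = b' x" if x: "x \<in> topspace X" for x
  proof -
    have "b x \<in> topspace K" using b(1) x by (auto simp: continuous_map_def)
    then have "(x, b x) \<in> \<Gamma>" using x by (simp add: \<Gamma>_def)
    then have "l (x, b x) = 1" using l1 by blast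
    then show ?thesis by (simp add: H_def G1)
  qed
  moreover have "H (t, (x0, y0)) = y0" if "t \<in> {0..1}" for t
  proof (cases "l (x0, y0) \<le> 1/2")
    case False
    have "y0 \<in> topspace K" using b(2) x0 by (auto simp: continuous_map_def)
    then have "l (x0, y0) \<in> {0..1}" using x0(1) by (intro l01) simp
    then have "t * (2 * l (x0, y0) - 1) \<in> {0..1}" using False that by (simp add: mult_le_one)
    then show ?thesis using False Gb x0 by (simp add: H_def)
  qed (simp add: H_def)
  ultimately show thesis by (intro that[of H]) (auto simp: H_def G0)
qed

text \<open>The end \<open>H (1, _)\<close> of the deformation acts over each point of
  \<open>X\<close> separately, so \<open>P f x\<close> reads \<open>f\<close> only at
  \<open>x\<close>. Since \<open>H\<close> takes values in \<open>K\<close>, the set of allowed maps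
  is preserved and the step can be repeated.\<close>

lemma ssim_at_close_maps:
  assumes X: "compact_space X" "Hausdorff_space X" and x0: "x0 \<in> topspace X"
    and Y: "Hausdorff_space Y" and K: "compactin Y K" and E: "finite E"
    and N: "openin (prod_topology (subtopology Y K) (subtopology Y K)) N"
    and hom: "homotopic_with (\<lambda>h. h (y0, y0) = y0)
                (subtopology (prod_topology (subtopology Y K) (subtopology Y K)) N) (subtopology Y K) fst snd"
    and a: "a \<in> based_maps X x0 Y y0"
    and b: "b \<in> based_maps X x0 Y y0" "b ` topspace X \<subseteq> K"
    and b': "b' \<in> based_maps X x0 Y y0" "b' ` topspace X \<subseteq> K"
    and bN: "\<And>x. x \<in> topspace X \<Longrightarrow> (b x, b' x) \<in> N"
    and ss: "ssim_at X x0 Y y0 r E {f \<in> based_maps X x0 Y y0. f ` topspace X \<subseteq> K} a b"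
  shows "ssim_at X x0 Y y0 r E {f \<in> based_maps X x0 Y y0. f ` topspace X \<subseteq> K} a b'"
proof -
  let ?K = "subtopology Y K"
  let ?M = "{f \<in> based_maps X x0 Y y0. f ` topspace X \<subseteq> K}"
  let ?I = "top_of_set {0..1::real}"
  have MK: "continuous_map X ?K f" if "f \<in> ?M" for f
    using that by (auto simp: based_maps_def continuous_map_in_subtopology)
  have cK: "compact_space ?K" using K by (rule compact_space_subtopology)
  have hK: "Hausdorff_space ?K" using Y by (rule Hausdorff_space_subtopology)
  have bM: "b \<in> ?M" "b' \<in> ?M" using b b' by auto
  have b'0: "b' x0 = y0" using b' by (simp add: based_maps_def)
  obtain H where H: "continuous_map (prod_topology ?I (prod_topology X ?K)) ?K H"
    and H0: "\<And>p. H (0, p) = snd p" and H1: "\<And>x. x \<in> topspace X \<Longrightarrow> H (1, (x, b x)) = b' x"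
    and Hb: "\<And>t. t \<in> {0..1} \<Longrightarrow> H (t, (x0, y0)) = y0"
    using graph_transport[OF X cK hK N hom MK[OF bM(1)] MK[OF bM(2)] x0 b'0 bN] by blast
  have H_comp: "continuous_map T ?K (\<lambda>q. H (\<tau> q, (\<alpha> q, \<beta> q)))"
    if "continuous_map T ?I \<tau>" "continuous_map T X \<alpha>" "continuous_map T ?K \<beta>" for T :: "'z topology" and \<tau> \<alpha> \<beta>
  proof -
    have "continuous_map T (prod_topology ?I (prod_topology X ?K)) (\<lambda>q. (\<tau> q, (\<alpha> q, \<beta> q)))"
      using that unfolding continuous_map_pairwise by (simp add: o_def)
    from continuous_map_compose[OF this H] show ?thesis by (simp add: o_def)
  qed
  define P where "P = (\<lambda>f. restrict (\<lambda>x. H (1, (x, f x))) (topspace X))"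
  have P_in: "P f \<in> ?M" and P_hom: "homotopic_with (\<lambda>h. h x0 = y0) X Y f (P f)" if f: "f \<in> ?M" for f
  proof -
    have f0: "f x0 = y0" using f by (simp add: based_maps_def)
    have "continuous_map X ?K (\<lambda>x. H (1, (x, f x)))"
      by (rule H_comp) (use MK[OF f] in auto)
    then have "continuous_map X ?K (P f)" by (rule continuous_map_eq) (simp add: P_def)
    then have "continuous_map X Y (P f)" "P f ` topspace X \<subseteq> K"
      by (auto simp: continuous_map_in_subtopology)
    moreover have "P f x0 = y0" "P f \<in> extensional (topspace X)"
      using Hb[of 1] f0 x0 by (auto simp: P_def)
    ultimately show "P f \<in> ?M" unfolding based_maps_def by blast
    have "continuous_map (prod_topology ?I X) ?K (\<lambda>q. H (fst q, (snd q, f (snd q))))"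
      by (rule H_comp) (use continuous_map_compose[OF continuous_map_snd MK[OF f]] in
          \<open>auto simp: o_def continuous_map_fst continuous_map_snd\<close>)
    then have "continuous_map (prod_topology ?I X) Y (\<lambda>q. H (fst q, (snd q, f (snd q))))"
      by (simp add: continuous_map_in_subtopology)
    then show "homotopic_with (\<lambda>h. h x0 = y0) X Y f (P f)"
      by (rule homotopic_with_basepoint_intro[OF x0]) (simp_all add: P_def H0 f0 Hb)
  qed
  have "P b = b'"
    using H1 b'(1) by (intro extensionalityI[of _ "topspace X"]) (auto simp: P_def based_maps_def)
  moreover have "ssim_at X x0 Y y0 r E ?M a (P b)"
  proof (rule ssim_at_push[OF X x0 E a a ss bM(1), where \<xi> = "\<lambda>x. x"])
    show "?M \<subseteq> based_maps X x0 Y y0" "?M \<subseteq> based_maps X x0 Y y0" by auto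
    show "P f \<in> ?M" if "f \<in> ?M" for f using that by (rule P_in)
    show "homotopic_with (\<lambda>h. h x0 = y0) X Y a (P f)"
      if "f \<in> ?M" "homotopic_with (\<lambda>h. h x0 = y0) X Y a f" for f
      using that(2) P_hom[OF that(1)] by (rule homotopic_with_trans)
    fix w assume w: "continuous_map (prod_topology (std_simplex E) X) Y (\<lambda>(u, x). w u x)"
      and wM: "\<And>u. u \<in> simplex_set E \<Longrightarrow> w u \<in> ?M"
    let ?T = "prod_topology (std_simplex E) X"
    have "(case q of (u, x) \<Rightarrow> w u x) \<in> K" if "q \<in> topspace ?T" for q
      using that wM by fastforce
    then have wK: "continuous_map ?T ?K (\<lambda>(u, x). w u x)"
      unfolding continuous_map_in_subtopology using w by blast
    have "continuous_map ?T ?K (\<lambda>q. H (1, (snd q, (case q of (u, x) \<Rightarrow> w u x))))"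
      by (rule H_comp) (use wK in \<open>auto simp: continuous_map_snd\<close>)
    then have "continuous_map ?T Y (\<lambda>q. H (1, (snd q, (case q of (u, x) \<Rightarrow> w u x))))"
      by (simp add: continuous_map_in_subtopology)
    then show "continuous_map ?T Y (\<lambda>(u, x). P (w u) x)"
      by (rule continuous_map_eq) (auto simp: P_def)
  qed (auto simp: P_def)
  ultimately show ?thesis by simp
qed

text \<open>The subcomplex must contain the values of all maps in \<open>S\<close>, so it is chosen
  after \<open>E\<close> and \<open>S\<close>, and the argument treats one \<open>E\<close> at a
  time. Along the homotopy the property is locally constant in the parameter, and the interval is
  connected.\<close>

lemma ssim_homotopic_right:
  assumes X: "compact_space X" "Hausdorff_space X" and x0: "x0 \<in> topspace X" and Y: "cellular Y y0"
    and a: "a \<in> based_maps X x0 Y y0" and b: "b \<in> based_maps X x0 Y y0" "b' \<in> based_maps X x0 Y y0"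
    and hom: "homotopic_with (\<lambda>h. h x0 = y0) X Y b b'" and ss: "ssim X x0 Y y0 r a b"
  shows "ssim X x0 Y y0 r a b'"
  unfolding ssim_iff_ssim_at[OF X x0 a]
proof (intro allI impI)
  fix E :: "nat set" assume E: "finite E \<and> E \<noteq> {}"
  let ?U = "std_simplex E"
  let ?I = "top_of_set {0..1::real}"
  let ?W = "umaps ?U (subtopology (mapspace X x0 Y y0) (path_component_of_set (mapspace X x0 Y y0) a))"
  obtain h where h: "continuous_map (prod_topology ?I X) Y h"
    and h01: "\<And>x. h (0, x) = b x" "\<And>x. h (1, x) = b' x" and hb: "\<And>t. t \<in> {0..1} \<Longrightarrow> h (t, x0) = y0"
    using hom unfolding homotopic_with_def by blast
  obtain S where S: "S \<in> fab ?W" "fissile E S"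
    and filt: "wr_filt X x0 ?U (r + 1) (\<lambda>w. gen (const_map ?U b) w - S w)"
    using ss E unfolding ssim_def by blast
  have finS: "finite {w. S w \<noteq> 0}" using S(1) by (simp add: fab_def)
  have SW: "continuous_map (prod_topology ?U X) Y (\<lambda>(u, x). w u x)"
    "\<And>u. u \<in> simplex_set E \<Longrightarrow> w u \<in> based_maps X x0 Y y0" if "S w \<noteq> 0" for w
  proof -
    have "w \<in> ?W" using S(1) that by (auto simp: fab_def)
    then show "continuous_map (prod_topology ?U X) Y (\<lambda>(u, x). w u x)"
      "\<And>u. u \<in> simplex_set E \<Longrightarrow> w u \<in> based_maps X x0 Y y0"
      by (simp_all add: umaps_path_component_mapspace[OF X x0 a])
  qed
  let ?img = "\<lambda>w. (\<lambda>(u, x). w u x) ` (simplex_set E \<times> topspace X)"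
  have "compactin Y (\<Union>(?img ` {w. S w \<noteq> 0}))"
  proof (rule compactin_Union)
    fix Z assume "Z \<in> ?img ` {w. S w \<noteq> 0}"
    then obtain w where w: "S w \<noteq> 0" and Z: "Z = ?img w" by blast
    have "compactin (prod_topology ?U X) (simplex_set E \<times> topspace X)"
      using compact_space_std_simplex X(1) E by (auto simp: compactin_Times compact_space_def)
    then show "compactin Y Z" unfolding Z using SW(1)[OF w] by (rule image_compactin)
  qed (use finS in simp)
  moreover have "compactin (prod_topology ?I X) ({0..1} \<times> topspace X)"
    using X(1) by (simp add: compactin_Times compact_space_def compactin_subtopology)
  then have "compactin Y (h ` ({0..1} \<times> topspace X))" using h by (rule image_compactin)
  ultimately have "compactin Y (\<Union>(?img ` {w. S w \<noteq> 0}) \<union> h ` ({0..1} \<times> topspace X))" (is "compactin Y ?Q")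
    by (rule compactin_Un)
  \<comment> \<open>One \<open>K\<close> serves the initial \<open>S\<close> and the whole homotopy,
    so the sums produced along the way keep their values in \<open>?M\<close>.\<close>
  with Y obtain K where K: "compactin Y K" and QK: "?Q \<subseteq> K" and "y0 \<in> K"
    and plan: "diag_planner (subtopology Y K) y0"
    by (rule cellular_compact_diag_planner)
  let ?K = "subtopology Y K"
  obtain N where N: "openin (prod_topology ?K ?K) N" and diag: "\<And>y. y \<in> topspace ?K \<Longrightarrow> (y, y) \<in> N"
    and homN: "homotopic_with (\<lambda>h. h (y0, y0) = y0) (subtopology (prod_topology ?K ?K) N) ?K fst snd"
    using plan unfolding diag_planner_def by blast
  let ?M = "{f \<in> based_maps X x0 Y y0. f ` topspace X \<subseteq> K}"
  define g where "g = (\<lambda>t. restrict (\<lambda>x. h (t, x)) (topspace X))"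
  have hK: "h (t, x) \<in> K" if "t \<in> {0..1}" "x \<in> topspace X" for t x using QK that by blast
  have gM: "g t \<in> ?M" if t: "t \<in> {0..1}" for t
  proof -
    have "continuous_map X Y (h \<circ> Pair t)" using h t by (intro continuous_map_o_Pair) auto
    then have "continuous_map X Y (g t)" by (rule continuous_map_eq) (simp add: g_def)
    then show ?thesis using hK[OF t] hb[OF t] x0 by (auto simp: based_maps_def g_def)
  qed
  have g01: "g 0 = b" "g 1 = b'" using b h01 by (auto simp: g_def based_maps_def extensional_restrict)
  have base: "ssim_at X x0 Y y0 r E ?M a b"
  proof -
    have "w u \<in> ?M" if "S w \<noteq> 0" "u \<in> simplex_set E" for w u
    proof -
      have "w u x \<in> K" if "x \<in> topspace X" for x
      proof -
        have "w u x \<in> ?img w" using that \<open>u \<in> simplex_set E\<close> by (intro image_eqI[of _ _ "(u, x)"]) auto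
        then show ?thesis using QK \<open>S w \<noteq> 0\<close> by blast
      qed
      then show ?thesis using SW(2)[OF that] by blast
    qed
    then show ?thesis unfolding ssim_at_def using S filt by blast
  qed
  have "ssim_at X x0 Y y0 r E ?M a (g 1)"
  proof (rule connected_induction_simple[of "{0..1::real}" 0 1])
    show "ssim_at X x0 Y y0 r E ?M a (g 0)" using base g01 by simp
    fix t0 :: real assume t0: "t0 \<in> {0..1}"
    let ?II = "prod_topology ?I ?I"
    let ?T = "prod_topology ?II X"
    have hKc: "continuous_map (prod_topology ?I X) ?K h"
      unfolding continuous_map_in_subtopology using h hK by auto
    have "continuous_map ?T (prod_topology ?I X) (\<lambda>q. (fst (fst q), snd q))"
      "continuous_map ?T (prod_topology ?I X) (\<lambda>q. (snd (fst q), snd q))"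
      unfolding continuous_map_pairwise o_def fst_conv snd_conv
      by (intro conjI continuous_map_snd continuous_map_compose[OF continuous_map_fst continuous_map_fst, unfolded o_def]
          continuous_map_compose[OF continuous_map_fst continuous_map_snd, unfolded o_def])+
    from this[THEN continuous_map_compose, OF hKc]
    have "continuous_map ?T (prod_topology ?K ?K) (\<lambda>q. (h (fst (fst q), snd q), h (snd (fst q), snd q)))"
      (is "continuous_map _ _ ?hh")
      unfolding continuous_map_pairwise by (simp add: o_def)
    \<comment> \<open>The pairs of times for which some \<open>x\<close> violates \<open>N\<close>
      are the projection of a closed set along the compact \<open>X\<close>. The complement is open
      and contains \<open>(t0, t0)\<close>, hence contains a product neighbourhood of it.\<close>
    then have "closedin ?T {q \<in> topspace ?T. ?hh q \<in> topspace (prod_topology ?K ?K) - N}"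
      by (rule closedin_continuous_map_preimage) (use N in blast)
    moreover have "closed_map ?T ?II fst" using X(1) by (rule closed_map_fst)
    ultimately have "closedin ?II (fst ` {q \<in> topspace ?T. ?hh q \<in> topspace (prod_topology ?K ?K) - N})"
      (is "closedin _ ?C") by (simp only: closed_map_def)
    then have "openin ?II (topspace ?II - ?C)" by blast
    moreover have "(t0, t0) \<in> topspace ?II - ?C"
    proof -
      have "h (t0, x) \<in> topspace ?K" if "x \<in> topspace X" for x
        using hK[OF t0 that] compactin_subset_topspace[OF K] by auto
      then have "(t0, t0) \<notin> ?C" using diag by auto
      then show ?thesis using t0 by simp
    qed
    ultimately obtain T1 T2 where T: "openin ?I T1" "openin ?I T2" "t0 \<in> T1" "t0 \<in> T2"
      and TC: "T1 \<times> T2 \<subseteq> topspace ?II - ?C"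
      unfolding openin_prod_topology_alt by meson
    show "\<exists>T. openin ?I T \<and> t0 \<in> T \<and>
        (\<forall>s\<in>T. \<forall>t\<in>T. ssim_at X x0 Y y0 r E ?M a (g s) \<longrightarrow> ssim_at X x0 Y y0 r E ?M a (g t))"
    proof (intro exI conjI ballI impI)
      show "openin ?I (T1 \<inter> T2)" "t0 \<in> T1 \<inter> T2" using T by auto
      fix s t assume s: "s \<in> T1 \<inter> T2" and t: "t \<in> T1 \<inter> T2"
        and ss: "ssim_at X x0 Y y0 r E ?M a (g s)"
      have st: "s \<in> {0..1}" "t \<in> {0..1}" using s t openin_subset[OF T(1)] by auto
      have "(g s x, g t x) \<in> N" if x: "x \<in> topspace X" for x
      proof (rule ccontr)
        assume "(g s x, g t x) \<notin> N"
        moreover have "h (s, x) \<in> topspace ?K" "h (t, x) \<in> topspace ?K"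
          using hK st x compactin_subset_topspace[OF K] by auto
        ultimately have "((s, t), x) \<in> {q \<in> topspace ?T. ?hh q \<in> topspace (prod_topology ?K ?K) - N}"
          using st x by (simp add: g_def)
        then have "(s, t) \<in> ?C" by (rule image_eqI[rotated]) simp
        then show False using TC s t by blast
      qed
      then show "ssim_at X x0 Y y0 r E ?M a (g t)"
        using gM[OF st(1)] gM[OF st(2)] E
        by (intro ssim_at_close_maps[OF X x0 cellular_imp_Hausdorff[OF Y] K _ N homN a _ _ _ _ _ ss]) auto
    qed
  qed auto
  then show "ssim_at X x0 Y y0 r E (based_maps X x0 Y y0) a b'"
    unfolding g01 ssim_at_def by blast
qed

section \<open>Translations\<close>

text \<open>The restriction makes the product extensional, as membership in
  \<open>based_maps\<close> demands; the multiplication of \<open>htpy_set\<close> uses the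
  unrestricted composite.\<close>

definition wedge_mult :: "'a topology \<Rightarrow> 'a \<Rightarrow> ('a \<Rightarrow> 'a \<times> 'a) \<Rightarrow> ('a \<Rightarrow> 'b) \<Rightarrow> ('a \<Rightarrow> 'b) \<Rightarrow> 'a \<Rightarrow> 'b" where
  "wedge_mult X x0 \<mu> c f = restrict (wedge_map x0 c f \<circ> \<mu>) (topspace X)"

lemma continuous_map_two_closed:
  assumes A: "closedin T A" and B: "closedin T B" and AB: "topspace T \<subseteq> A \<union> B"
    and f: "continuous_map T Z f" and g: "continuous_map T Z g"
    and kA: "\<And>q. q \<in> A \<Longrightarrow> k q = f q" and kB: "\<And>q. q \<in> B \<Longrightarrow> k q = g q"
  shows "continuous_map T Z k"
  unfolding continuous_map_closedin
proof (intro conjI allI impI)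
  show "k \<in> topspace T \<rightarrow> topspace Z"
    using AB f g kA kB unfolding continuous_map_def by (fastforce simp: Pi_iff)
  fix C assume C: "closedin Z C"
  have "closedin T (A \<inter> {q \<in> topspace T. f q \<in> C})" "closedin T (B \<inter> {q \<in> topspace T. g q \<in> C})"
    using A B C f g by (auto intro!: closedin_Int closedin_continuous_map_preimage)
  moreover have "{q \<in> topspace T. k q \<in> C}
      = (A \<inter> {q \<in> topspace T. f q \<in> C}) \<union> (B \<inter> {q \<in> topspace T. g q \<in> C})"
    using AB kA kB by auto
  ultimately show "closedin T {q \<in> topspace T. k q \<in> C}" by (simp add: closedin_Un)
qed

text \<open>Each \<open>\<mu> x\<close> lies on an axis of the wedge, so two closed sets cover: on
  one the product is \<open>c\<close> of the first component, on the other it is \<open>w u\<close>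
  of the second. The parameter space \<open>U\<close> is the interval for homotopies and a simplex
  for the maps in \<open>S\<close>.\<close>

lemma continuous_map_wedge_mult:
  assumes X: "Hausdorff_space X" and x0: "x0 \<in> topspace X"
    and \<mu>: "continuous_map X (wedge X x0) \<mu>" and c: "continuous_map X Y c" "c x0 = y0"
    and w: "continuous_map (prod_topology U X) Y (\<lambda>(u, x). w u x)"
    and w0: "\<And>u. u \<in> topspace U \<Longrightarrow> w u x0 = y0"
  shows "continuous_map (prod_topology U X) Y (\<lambda>(u, x). wedge_mult X x0 \<mu> c (w u) x)"
proof -
  let ?T = "prod_topology U X"
  have \<mu>X: "continuous_map X (prod_topology X X) \<mu>"
    and \<mu>w: "\<And>x. x \<in> topspace X \<Longrightarrow> fst (\<mu> x) = x0 \<or> snd (\<mu> x) = x0"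
    using \<mu> by (auto simp: wedge_def continuous_map_in_subtopology Pi_iff case_prod_beta)
  have m1: "continuous_map ?T X (\<lambda>q. fst (\<mu> (snd q)))" and m2: "continuous_map ?T X (\<lambda>q. snd (\<mu> (snd q)))"
    using continuous_map_compose[OF continuous_map_compose[OF continuous_map_snd \<mu>X] continuous_map_fst]
      continuous_map_compose[OF continuous_map_compose[OF continuous_map_snd \<mu>X] continuous_map_snd]
    by (simp_all add: o_def)
  have cl: "closedin X {x0}" using X x0 by (simp add: closedin_Hausdorff_singleton)
  have A: "closedin ?T {q \<in> topspace ?T. snd (\<mu> (snd q)) \<in> {x0}}" (is "closedin ?T ?A")
    and B: "closedin ?T {q \<in> topspace ?T. fst (\<mu> (snd q)) \<in> {x0}}" (is "closedin ?T ?B")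
    using closedin_continuous_map_preimage[OF m2 cl] closedin_continuous_map_preimage[OF m1 cl] by blast+
  have f: "continuous_map ?T Y (\<lambda>q. c (fst (\<mu> (snd q))))"
    using continuous_map_compose[OF m1 c(1)] by (simp add: o_def)
  have "continuous_map ?T ?T (\<lambda>q. (fst q, snd (\<mu> (snd q))))"
    using m2 by (simp add: continuous_map_pairwise o_def continuous_map_fst)
  from continuous_map_compose[OF this w]
  have g: "continuous_map ?T Y (\<lambda>q. w (fst q) (snd (\<mu> (snd q))))" by (simp add: o_def)
  show ?thesis
  proof (rule continuous_map_two_closed[OF A B _ f g])
    show "topspace ?T \<subseteq> ?A \<union> ?B" by (auto dest: \<mu>w)
    show "(case q of (u, x) \<Rightarrow> wedge_mult X x0 \<mu> c (w u) x) = c (fst (\<mu> (snd q)))" if "q \<in> ?A" for q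
      using that by (auto simp: wedge_mult_def wedge_map_def case_prod_beta)
    \<comment> \<open>If both components are \<open>x0\<close>, \<open>wedge_map\<close> takes its
      \<open>c\<close> branch, but \<open>c x0\<close> and \<open>w u x0\<close> are both
      \<open>y0\<close>.\<close>
    show "(case q of (u, x) \<Rightarrow> wedge_mult X x0 \<mu> c (w u) x) = w (fst q) (snd (\<mu> (snd q)))" if "q \<in> ?B" for q
      using that w0 c(2) by (auto simp: wedge_mult_def wedge_map_def case_prod_beta)
  qed
qed

lemma homotopic_wedge_mult:
  assumes X: "Hausdorff_space X" and x0: "x0 \<in> topspace X"
    and \<mu>: "continuous_map X (wedge X x0) \<mu>" "\<mu> x0 = (x0, x0)" and c: "continuous_map X Y c" "c x0 = y0"
    and hom: "homotopic_with (\<lambda>h. h x0 = y0) X Y f g"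
  shows "homotopic_with (\<lambda>h. h x0 = y0) X Y (wedge_mult X x0 \<mu> c f) (wedge_mult X x0 \<mu> c g)"
proof -
  let ?I = "top_of_set {0..1::real}"
  obtain h where h: "continuous_map (prod_topology ?I X) Y h"
    and h01: "\<And>x. h (0, x) = f x" "\<And>x. h (1, x) = g x" and hb: "\<And>t. t \<in> {0..1} \<Longrightarrow> h (t, x0) = y0"
    using hom unfolding homotopic_with_def by blast
  have "continuous_map (prod_topology ?I X) Y (\<lambda>(t, x). wedge_mult X x0 \<mu> c (\<lambda>x. h (t, x)) x)"
    by (rule continuous_map_wedge_mult[OF X x0 \<mu>(1) c]) (use h hb in auto)
  then show ?thesis
    by (rule homotopic_with_basepoint_intro[OF x0])
       (use x0 c in \<open>auto simp: wedge_mult_def wedge_map_def case_prod_beta h01 \<mu>(2)\<close>)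
qed

lemma wedge_mult_based:
  assumes X: "Hausdorff_space X" and x0: "x0 \<in> topspace X"
    and \<mu>: "continuous_map X (wedge X x0) \<mu>" "\<mu> x0 = (x0, x0)"
    and c: "c \<in> based_maps X x0 Y y0" and f: "f \<in> based_maps X x0 Y y0"
  shows "wedge_mult X x0 \<mu> c f \<in> based_maps X x0 Y y0"
proof -
  \<comment> \<open>A homotopy of a map to itself records exactly its continuity and its value at
    the basepoint.\<close>
  have "homotopic_with (\<lambda>h. h x0 = y0) X Y (wedge_mult X x0 \<mu> c f) (wedge_mult X x0 \<mu> c f)"
    using c f by (intro homotopic_wedge_mult[OF X x0 \<mu>]) (auto simp: based_maps_def)
  then show ?thesis by (simp add: based_maps_def wedge_mult_def)
qed

text \<open>The point read is \<open>snd (\<mu> x)\<close>: if it is \<open>x0\<close>, the value is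
  \<open>c (fst (\<mu> x))\<close> whatever \<open>f\<close> is; otherwise it is
  \<open>f (snd (\<mu> x))\<close>.\<close>

lemma ssim_wedge_mult:
  assumes X: "compact_space X" "Hausdorff_space X" and x0: "x0 \<in> topspace X"
    and \<mu>: "continuous_map X (wedge X x0) \<mu>" "\<mu> x0 = (x0, x0)"
    and c: "c \<in> based_maps X x0 Y y0" and a: "a \<in> based_maps X x0 Y y0" and b: "b \<in> based_maps X x0 Y y0"
    and ss: "ssim X x0 Y y0 r a b"
  shows "ssim X x0 Y y0 r (wedge_mult X x0 \<mu> c a) (wedge_mult X x0 \<mu> c b)"
proof -
  let ?B = "based_maps X x0 Y y0"
  let ?P = "wedge_mult X x0 \<mu> c"
  have P: "?P f \<in> ?B" if "f \<in> ?B" for f using X(2) x0 \<mu> c that by (rule wedge_mult_based)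
  have c': "continuous_map X Y c" "c x0 = y0" using c by (auto simp: based_maps_def)
  have "ssim_at X x0 Y y0 r E ?B (?P a) (?P b)" if E: "finite E \<and> E \<noteq> {}" for E
  proof (rule ssim_at_push[OF X x0 _ a P[OF a] _ b, where \<xi> = "\<lambda>x. snd (\<mu> x)"])
    show "ssim_at X x0 Y y0 r E ?B a b" using ss E ssim_iff_ssim_at[OF X x0 a] by blast
    show "snd (\<mu> x) \<in> topspace X" if "x \<in> topspace X" for x
    proof -
      have "\<mu> x \<in> topspace (wedge X x0)" using \<mu>(1) that by (auto simp: continuous_map_def)
      then show ?thesis by (auto simp: wedge_def)
    qed
    show "homotopic_with (\<lambda>h. h x0 = y0) X Y (?P a) (?P f)"
      if "homotopic_with (\<lambda>h. h x0 = y0) X Y a f" for f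
      using that by (rule homotopic_wedge_mult[OF X(2) x0 \<mu> c'])
    show "continuous_map (prod_topology (std_simplex E) X) Y (\<lambda>(u, x). ?P (w u) x)"
      if "continuous_map (prod_topology (std_simplex E) X) Y (\<lambda>(u, x). w u x)"
        "\<And>u. u \<in> simplex_set E \<Longrightarrow> w u \<in> ?B" for w
      using that by (intro continuous_map_wedge_mult[OF X(2) x0 \<mu>(1) c']) (auto simp: based_maps_def)
    show "?P f x = ?P g x" if "f (snd (\<mu> x)) = g (snd (\<mu> x))" for f g x
      using that by (simp add: wedge_mult_def wedge_map_def case_prod_beta)
  qed (use E P in auto)
  then show ?thesis using ssim_iff_ssim_at[OF X x0 P[OF a]] by blast
qed

section \<open>Homotopy classes and their chosen representatives\<close>

lemma hcls_eqI:
  assumes "homotopic_with (\<lambda>h. h x0 = y0) X Y f g"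
  shows "hcls X x0 Y y0 f = hcls X x0 Y y0 g"
  unfolding hcls_def using assms by (blast intro: homotopic_with_trans homotopic_with_symD)

lemma hrep_hcls:
  assumes "f \<in> based_maps X x0 Y y0"
  shows "hrep (hcls X x0 Y y0 f) \<in> based_maps X x0 Y y0"
    "homotopic_with (\<lambda>h. h x0 = y0) X Y f (hrep (hcls X x0 Y y0 f))"
proof -
  have "f \<in> hcls X x0 Y y0 f" using assms by (simp add: hcls_def based_maps_def)
  then have "hrep (hcls X x0 Y y0 f) \<in> hcls X x0 Y y0 f" unfolding hrep_def by (rule someI[of "\<lambda>c. c \<in> hcls X x0 Y y0 f"])
  then show "hrep (hcls X x0 Y y0 f) \<in> based_maps X x0 Y y0"
    "homotopic_with (\<lambda>h. h x0 = y0) X Y f (hrep (hcls X x0 Y y0 f))" by (simp_all add: hcls_def)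
qed

lemma hrep_htpy_set:
  "A \<in> carrier (htpy_set X x0 \<mu> Y y0) \<Longrightarrow> hrep A \<in> based_maps X x0 Y y0"
  by (auto simp: htpy_set_def hrep_hcls)

text \<open>\<open>hrep\<close> chooses the representative of the product class arbitrarily, so only
  a homotopy is available; this is what calls for invariance in both arguments of
  \<open>ssim\<close>.\<close>

lemma hrep_htpy_mult:
  assumes X: "Hausdorff_space X" and x0: "x0 \<in> topspace X"
    and \<mu>: "continuous_map X (wedge X x0) \<mu>" "\<mu> x0 = (x0, x0)"
    and A: "A \<in> carrier (htpy_set X x0 \<mu> Y y0)" and B: "B \<in> carrier (htpy_set X x0 \<mu> Y y0)"
  shows "homotopic_with (\<lambda>h. h x0 = y0) X Y (wedge_mult X x0 \<mu> (hrep A) (hrep B))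
           (hrep (A \<otimes>\<^bsub>htpy_set X x0 \<mu> Y y0\<^esub> B))"
proof -
  let ?m = "wedge_mult X x0 \<mu> (hrep A) (hrep B)"
  have m: "?m \<in> based_maps X x0 Y y0"
    using X x0 \<mu> hrep_htpy_set[OF A] hrep_htpy_set[OF B] by (rule wedge_mult_based)
  have "homotopic_with (\<lambda>h. h x0 = y0) X Y ?m (wedge_map x0 (hrep A) (hrep B) \<circ> \<mu>)"
    using m x0 by (intro homotopic_with_equal) (auto simp: based_maps_def wedge_mult_def)
  from hcls_eqI[OF this] have "A \<otimes>\<^bsub>htpy_set X x0 \<mu> Y y0\<^esub> B = hcls X x0 Y y0 ?m"
    by (simp add: htpy_set_def)
  then show ?thesis using hrep_hcls(2)[OF m] by simp
qed

lemma ssim_cls_left_mult: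
  assumes X: "compact_space X" "Hausdorff_space X" and x0: "x0 \<in> topspace X" and Y: "cellular Y y0"
    and \<mu>: "continuous_map X (wedge X x0) \<mu>" "\<mu> x0 = (x0, x0)"
    and grp: "group (htpy_set X x0 \<mu> Y y0)"
    and C: "C \<in> carrier (htpy_set X x0 \<mu> Y y0)" and A: "A \<in> carrier (htpy_set X x0 \<mu> Y y0)" and B: "B \<in> carrier (htpy_set X x0 \<mu> Y y0)"
    and ss: "ssim_cls X x0 Y y0 r A B"
  shows "ssim_cls X x0 Y y0 r (C \<otimes>\<^bsub>htpy_set X x0 \<mu> Y y0\<^esub> A) (C \<otimes>\<^bsub>htpy_set X x0 \<mu> Y y0\<^esub> B)"
proof -
  let ?G = "htpy_set X x0 \<mu> Y y0"
  interpret group ?G by (rule grp)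
  note rep = hrep_htpy_set[OF C] hrep_htpy_set[OF A] hrep_htpy_set[OF B]
  have based: "wedge_mult X x0 \<mu> (hrep C) (hrep A) \<in> based_maps X x0 Y y0"
    "wedge_mult X x0 \<mu> (hrep C) (hrep B) \<in> based_maps X x0 Y y0"
    using rep by (auto intro: wedge_mult_based[OF X(2) x0 \<mu>])
  have prod: "hrep (C \<otimes>\<^bsub>?G\<^esub> A) \<in> based_maps X x0 Y y0" "hrep (C \<otimes>\<^bsub>?G\<^esub> B) \<in> based_maps X x0 Y y0"
    using A B C by (auto intro: hrep_htpy_set)
  have "ssim X x0 Y y0 r (wedge_mult X x0 \<mu> (hrep C) (hrep A)) (wedge_mult X x0 \<mu> (hrep C) (hrep B))"
    using ss unfolding ssim_cls_def by (rule ssim_wedge_mult[OF X x0 \<mu> rep])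
  then have "ssim X x0 Y y0 r (hrep (C \<otimes>\<^bsub>?G\<^esub> A)) (wedge_mult X x0 \<mu> (hrep C) (hrep B))"
    by (rule ssim_homotopic_left[OF X x0 based(1) prod(1) based(2)
          homotopic_with_symD[OF hrep_htpy_mult[OF X(2) x0 \<mu> C A]]])
  then show ?thesis
    unfolding ssim_cls_def
    by (rule ssim_homotopic_right[OF X x0 Y prod(1) based(2) prod(2) hrep_htpy_mult[OF X(2) x0 \<mu> C B]])
qed

theorem theorem8p2:
  fixes X :: "'a topology" and x0 :: 'a and Y :: "'b topology" and y0 :: 'b
    and \<mu> :: "'a \<Rightarrow> 'a \<times> 'a" and \<nu> :: "'a \<Rightarrow> 'a" and r :: nat
    and A B :: "('a \<Rightarrow> 'b) set"
  assumes "cellular X x0" and "cellular Y y0" and "compact_space X"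
    and "admissible X x0 \<mu> \<nu> Y y0"
    and "A \<in> carrier (htpy_set X x0 \<mu> Y y0)" and "B \<in> carrier (htpy_set X x0 \<mu> Y y0)"
  shows "ssim_cls X x0 Y y0 r A B \<longleftrightarrow>
         inv\<^bsub>htpy_set X x0 \<mu> Y y0\<^esub> A \<otimes>\<^bsub>htpy_set X x0 \<mu> Y y0\<^esub> B
           \<in> htpy_filt X x0 \<mu> Y y0 r"
proof -
  let ?G = "htpy_set X x0 \<mu> Y y0"
  have grp: "group ?G" and \<mu>: "continuous_map X (wedge X x0) \<mu>" "\<mu> x0 = (x0, x0)"
    using assms(4) by (auto simp: admissible_def)
  interpret group ?G by (rule grp)
  note left_mult = ssim_cls_left_mult[OF assms(3) cellular_imp_Hausdorff[OF assms(1)]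
      cellular_imp_basepoint[OF assms(1)] assms(2) \<mu> grp]
  have AB: "inv\<^bsub>?G\<^esub> A \<otimes>\<^bsub>?G\<^esub> B \<in> carrier ?G" using assms(5,6) by simp
  show ?thesis
  proof
    assume "ssim_cls X x0 Y y0 r A B"
    then have "ssim_cls X x0 Y y0 r (inv\<^bsub>?G\<^esub> A \<otimes>\<^bsub>?G\<^esub> A) (inv\<^bsub>?G\<^esub> A \<otimes>\<^bsub>?G\<^esub> B)"
      using assms(5,6) by (intro left_mult) simp_all
    then show "inv\<^bsub>?G\<^esub> A \<otimes>\<^bsub>?G\<^esub> B \<in> htpy_filt X x0 \<mu> Y y0 r"
      using AB assms(5) by (simp add: htpy_filt_def)
  next
    assume "inv\<^bsub>?G\<^esub> A \<otimes>\<^bsub>?G\<^esub> B \<in> htpy_filt X x0 \<mu> Y y0 r"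
    then have "ssim_cls X x0 Y y0 r \<one>\<^bsub>?G\<^esub> (inv\<^bsub>?G\<^esub> A \<otimes>\<^bsub>?G\<^esub> B)"
      by (simp add: htpy_filt_def)
    then have "ssim_cls X x0 Y y0 r (A \<otimes>\<^bsub>?G\<^esub> \<one>\<^bsub>?G\<^esub>) (A \<otimes>\<^bsub>?G\<^esub> (inv\<^bsub>?G\<^esub> A \<otimes>\<^bsub>?G\<^esub> B))"
      using assms(5) AB by (intro left_mult) simp_all
    moreover have "A \<otimes>\<^bsub>?G\<^esub> (inv\<^bsub>?G\<^esub> A \<otimes>\<^bsub>?G\<^esub> B) = B"
      using assms(5,6) by (simp flip: m_assoc)
    ultimately show "ssim_cls X x0 Y y0 r A B" using assms(5) by simp
  qed
qed

end
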